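(* Let $G$ be an $n$-vertex graph with lambda chromatic number $t\ge 3$ and $n\ge t+1$. Then $G$ contains maximum number of edges if and only if exactly one of the following holds. (i) $n\equiv 0 \pmod{t+1}$ and $G$ is isomorphic to an $n$-vertex member graph $G^{*}$ of $\mathsf{G}(t,\frac{n}{t+1})$. (ii) $n\not\equiv 0\pmod{t+1}$ and $G$ is isomorphic to an $n$-vertex stationary graph, with partition $V_0,\ldots,V_t$, satisfying property (a) of the definition of stationary graph, such that the value $\mathrm{K}_G(V_0,\ldots,V_t)$ is minimum over all equitable partitions into $t+1$ unequally sized parts (i.e. not all of the same size) of the vertex sets of all possible $n$-vertex graphs. (iii) $n\not\equiv 0\pmod{t+1}$ and $G$ is isomorphic to an $n$-vertex stationary graph satisfying exactly one of the properties (b) to (g) of the definition of stationary graph.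
   Context: All graphs are simple, with finite non-empty vertex set. $d_G(u,v)$ denotes distance in $G$ ($\infty$ if no path joins $u$ and $v$). A lambda colouring of $G$ is a map $c:V(G)\to\mathbb{N}=\{0,1,2,\ldots\}$ with $|c(u)-c(v)|+d_G(u,v)\ge 3$ for all distinct vertices $u,v$, normalised so that $\min_u c(u)=0$. The lambda chromatic number of $G$ is the minimum of $\max_u c(u)$ over all lambda colourings $c$. An $n$-vertex graph with lambda chromatic number $t$ "contains maximum number of edges" if no $n$-vertex graph with lambda chromatic number $t$ has more edges. For integers $t\ge3$, $l\ge1$, $\mathsf{G}(t,l)$ is the family of graphs $H$ whose vertex set is a disjoint union $V_0\sqcup\cdots\sqcup V_t$ of sets of size $l$ such that: whenever $0\le m\le p-2\le t-2$, the edges between $V_m$ and $V_p$ form a perfect matching; no edge has both ends in the same $V_m$; and there are no edges between $V_m$ and $V_{m+1}$. For a partition $U_0,\ldots,U_t$ of $V(G)$, $\mathrm{K}_G(U_0,\ldots,U_t)$ is the number of indices $i$, $0\le i\le t-1$, with $|U_i|=|U_{i+1}|=\max_{0\le j\le t}|U_j|$. The partition is equitable if $\big||U_i|-|U_j|\big|\le1$ for all $i,j$. $e_G(X,Y)$ is the number of edges $\{x,y\}$ with $x\in X$, $y\in Y$. An $n$-vertex graph $G$ is a stationary graph (with parameter $t$) if its vertex set is partitioned into $t+1$ subsets $V_0,\ldots,V_t$ (possibly some empty), where $n\ge t+1\ge4$, such that: - $V_0$ and $V_t$ are non-empty, and if $V_i$ is empty for some $1\le i\le t-1$ then both $V_{i-1}$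 and $V_{i+1}$ are non-empty; - $e_G(V_i,V_i)=0$ for $0\le i\le t$; - $e_G(V_i,V_{i+1})=0$ for $0\le i\le t-1$; - if $0<|V_i|\le|V_j|$ with $0\le i,j\le t$ and $|i-j|\ge2$, then for each $x\in V_i$ there is a unique $y\in V_j$ such that $\{x,y\}$ is an edge (so $e_G(V_i,V_j)=|V_i|=\min\{|V_i|,|V_j|\}$); and moreover this partition, or its dual partition $\bar V_0,\ldots,\bar V_t$ with $\bar V_i=V_{t-i}$, satisfies exactly one of: (a) $\big||V_i|-|V_j|\big|\le1$ for all $0\le i,j\le t$; (b) $t=3$ and $|V_0|=|V_1|+1=|V_2|+2=|V_3|$; (c) $t=3$ and $|V_0|+1=|V_1|=|V_2|+2=|V_3|$; (d) $t=3$ and $|V_0|=|V_1|+2=|V_2|=|V_3|$; (e) $t=3$ and $|V_0|=|V_1|+3=|V_2|=|V_3|$; (f) $t=4$ and $|V_0|=|V_1|+2=|V_2|=|V_3|+1=|V_4|$; (g) $t=4$ and $|V_0|=|V_1|+2=|V_2|=|V_3|+2=|V_4|$; (h) $t=4$ and $|V_0|=|V_1|=|V_2|+2=|V_3|=|V_4|$.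
   Formalization: "Exactly one of (i)–(iii)" is asserted for some copy of G with one fixed partition, not for G over all partitions: for t=3, n=5, the disjoint union of a 3-vertex and a 2-vertex path satisfies both (ii) and (iii). Competing graphs have natural-number vertices. *)

theory Defs
  imports "Graph_Theory.Graph_Theory" "HOL-Library.Disjoint_Sets"
begin

text \<open>A simple graph is a finite, symmetric, loop-free digraph with a non-empty vertex set; an
  undirected edge is a pair of opposite arcs, so edges are counted as two-element vertex sets.\<close>

definition simple_graph :: "'a pair_pre_digraph \<Rightarrow> bool" where
  "simple_graph G \<longleftrightarrow> pair_graph G \<and> pverts G \<noteq> {}"

definition edge_count :: "'a pair_pre_digraph \<Rightarrow> nat" where
  "edge_count G = card {{x, y} | x y. (x, y) \<in> parcs G}"

definition edges_between :: "'a pair_pre_digraph \<Rightarrow> 'a set \<Rightarrow> 'a set \<Rightarrow> nat" where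
  "edges_between G X Y = card {{x, y} | x y. x \<in> X \<and> y \<in> Y \<and> (x, y) \<in> parcs G}"

definition graph_dist :: "'a pair_pre_digraph \<Rightarrow> 'a \<Rightarrow> 'a \<Rightarrow> ereal" where
  "graph_dist G u v = wf_digraph.\<mu> (with_proj G) (\<lambda>_. 1) u v"

definition graph_isomorphic :: "'a pair_pre_digraph \<Rightarrow> 'b pair_pre_digraph \<Rightarrow> bool" where
  "graph_isomorphic G H \<longleftrightarrow> digraph_iso (with_proj G) (with_proj H)"

definition lambda_colouring :: "'a pair_pre_digraph \<Rightarrow> ('a \<Rightarrow> nat) \<Rightarrow> bool" where
  "lambda_colouring G c \<longleftrightarrow>
     (\<forall>u\<in>pverts G. \<forall>v\<in>pverts G. u \<noteq> v \<longrightarrow>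
        ereal \<bar>real (c u) - real (c v)\<bar> + graph_dist G u v \<ge> 3) \<and>
     Min (c ` pverts G) = 0"

definition lambda_number :: "'a pair_pre_digraph \<Rightarrow> nat" where
  "lambda_number G = (LEAST k. \<exists>c. lambda_colouring G c \<and> Max (c ` pverts G) = k)"

text \<open>Competing graphs range over vertex type \<open>nat\<close>, which contains a copy of every finite graph.\<close>

definition has_max_edges :: "'a pair_pre_digraph \<Rightarrow> bool" where
  "has_max_edges G \<longleftrightarrow>
     (\<forall>H :: nat pair_pre_digraph. simple_graph H \<and> card (pverts H) = card (pverts G) \<and>
        lambda_number H = lambda_number G \<longrightarrow> edge_count H \<le> edge_count G)"

text \<open>Only the values \<open>U 0, \<dots>, U t\<close> matter; parts may be empty.\<close>

definition indexed_partition :: "nat \<Rightarrow> 'a set \<Rightarrow> (nat \<Rightarrow> 'a set) \<Rightarrow> bool" where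
  "indexed_partition t A U \<longleftrightarrow> disjoint_family_on U {..t} \<and> (\<Union>i\<le>t. U i) = A"

definition perfect_matching_between ::
    "'a pair_pre_digraph \<Rightarrow> 'a set \<Rightarrow> 'a set \<Rightarrow> bool" where
  "perfect_matching_between G X Y \<longleftrightarrow>
     (\<forall>x\<in>X. \<exists>!y. y \<in> Y \<and> (x, y) \<in> parcs G) \<and> (\<forall>y\<in>Y. \<exists>!x. x \<in> X \<and> (x, y) \<in> parcs G)"

definition G_family :: "nat \<Rightarrow> nat \<Rightarrow> 'a pair_pre_digraph set" where
  "G_family t l = {H. simple_graph H \<and> (\<exists>V. indexed_partition t (pverts H) V \<and>
     (\<forall>i\<le>t. card (V i) = l) \<and>
     (\<forall>m p. m + 2 \<le> p \<and> p \<le> t \<longrightarrow> perfect_matching_between H (V m) (V p)) \<and>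
     (\<forall>m\<le>t. edges_between H (V m) (V m) = 0) \<and>
     (\<forall>m<t. edges_between H (V m) (V (m + 1)) = 0))}"

definition K_value :: "nat \<Rightarrow> (nat \<Rightarrow> 'a set) \<Rightarrow> nat" where
  "K_value t U = card {i. i < t \<and> card (U i) = card (U (i + 1)) \<and>
     card (U (i + 1)) = Max ((\<lambda>j. card (U j)) ` {..t})}"

definition equitable :: "nat \<Rightarrow> (nat \<Rightarrow> 'a set) \<Rightarrow> bool" where
  "equitable t U \<longleftrightarrow> (\<forall>i\<le>t. \<forall>j\<le>t. \<bar>int (card (U i)) - int (card (U j))\<bar> \<le> 1)"

definition equally_sized :: "nat \<Rightarrow> (nat \<Rightarrow> 'a set) \<Rightarrow> bool" where
  "equally_sized t U \<longleftrightarrow> (\<forall>i\<le>t. \<forall>j\<le>t. card (U i) = card (U j))"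

definition dual_partition :: "nat \<Rightarrow> (nat \<Rightarrow> 'a set) \<Rightarrow> nat \<Rightarrow> 'a set" where
  "dual_partition t V = (\<lambda>i. V (t - i))"

datatype size_prop = Pa | Pb | Pc | Pd | Pe | Pf | Pg | Ph

fun satisfies :: "nat \<Rightarrow> (nat \<Rightarrow> 'a set) \<Rightarrow> size_prop \<Rightarrow> bool" where
  "satisfies t V Pa \<longleftrightarrow> equitable t V"
| "satisfies t V Pb \<longleftrightarrow> t = 3 \<and> card (V 0) = card (V 1) + 1 \<and>
     card (V 1) + 1 = card (V 2) + 2 \<and> card (V 2) + 2 = card (V 3)"
| "satisfies t V Pc \<longleftrightarrow> t = 3 \<and> card (V 0) + 1 = card (V 1) \<and>
     card (V 1) = card (V 2) + 2 \<and> card (V 2) + 2 = card (V 3)"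
| "satisfies t V Pd \<longleftrightarrow> t = 3 \<and> card (V 0) = card (V 1) + 2 \<and>
     card (V 1) + 2 = card (V 2) \<and> card (V 2) = card (V 3)"
| "satisfies t V Pe \<longleftrightarrow> t = 3 \<and> card (V 0) = card (V 1) + 3 \<and>
     card (V 1) + 3 = card (V 2) \<and> card (V 2) = card (V 3)"
| "satisfies t V Pf \<longleftrightarrow> t = 4 \<and> card (V 0) = card (V 1) + 2 \<and>
     card (V 1) + 2 = card (V 2) \<and> card (V 2) = card (V 3) + 1 \<and> card (V 3) + 1 = card (V 4)"
| "satisfies t V Pg \<longleftrightarrow> t = 4 \<and> card (V 0) = card (V 1) + 2 \<and>
     card (V 1) + 2 = card (V 2) \<and> card (V 2) = card (V 3) + 2 \<and> card (V 3) + 2 = card (V 4)"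
| "satisfies t V Ph \<longleftrightarrow> t = 4 \<and> card (V 0) = card (V 1) \<and>
     card (V 1) = card (V 2) + 2 \<and> card (V 2) + 2 = card (V 3) \<and> card (V 3) = card (V 4)"

definition satisfies_exactly_one_of ::
    "nat \<Rightarrow> (nat \<Rightarrow> 'a set) \<Rightarrow> size_prop set \<Rightarrow> bool" where
  "satisfies_exactly_one_of t V P \<longleftrightarrow>
     (\<exists>W \<in> {V, dual_partition t V}. \<exists>!p. p \<in> P \<and> satisfies t W p)"

text \<open>A stationary graph is taken together with its partition \<open>V\<close>: the same graph can carry several
  stationary partitions with different size patterns.\<close>

definition stationary_graph :: "nat \<Rightarrow> 'a pair_pre_digraph \<Rightarrow> (nat \<Rightarrow> 'a set) \<Rightarrow> bool" where
  "stationary_graph t H V \<longleftrightarrow>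
     simple_graph H \<and> card (pverts H) \<ge> t + 1 \<and> t + 1 \<ge> 4 \<and>
     indexed_partition t (pverts H) V \<and>
     V 0 \<noteq> {} \<and> V t \<noteq> {} \<and>
     (\<forall>i. 1 \<le> i \<and> i \<le> t - 1 \<and> V i = {} \<longrightarrow> V (i - 1) \<noteq> {} \<and> V (i + 1) \<noteq> {}) \<and>
     (\<forall>i\<le>t. edges_between H (V i) (V i) = 0) \<and>
     (\<forall>i<t. edges_between H (V i) (V (i + 1)) = 0) \<and>
     (\<forall>i\<le>t. \<forall>j\<le>t. 0 < card (V i) \<and> card (V i) \<le> card (V j) \<and> \<bar>int i - int j\<bar> \<ge> 2 \<longrightarrow>
        (\<forall>x\<in>V i. \<exists>!y. y \<in> V j \<and> (x, y) \<in> parcs H)) \<and>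
     satisfies_exactly_one_of t V UNIV"

definition exactly_one_of_three :: "bool \<Rightarrow> bool \<Rightarrow> bool \<Rightarrow> bool" where
  "exactly_one_of_three P Q R \<longleftrightarrow>
     (P \<and> \<not> Q \<and> \<not> R) \<or> (\<not> P \<and> Q \<and> \<not> R) \<or> (\<not> P \<and> \<not> Q \<and> R)"

end

theory Submission
  imports Defs
begin

text \<open>
Let \<open>c\<close> be a lambda colouring with values in \<open>0, \<dots>, t\<close> and let \<open>V i\<close> be the set of vertices
  of colour \<open>i\<close>. There are no edges inside a class or between classes of consecutive colours, and
  two vertices of one class have no common neighbour, so the edges between any two other classes
  form a matching. Hence \<open>G\<close> has at most \<open>\<Sum> min (card (V i)) (card (V j))\<close> edges, summed over
  \<open>i + 2 \<le> j\<close> (\<open>matching_total\<close>), with equality exactly when each of these matchings covers the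
  smaller of its two classes (\<open>saturated\<close>). Conversely, such a matched partition whose two end
  classes are non-empty is a lambda colouring with largest value \<open>t\<close>. What remains is to maximise
  \<open>matching_total t a\<close> over all size vectors \<open>a\<close> with sum \<open>n\<close>.

  Cut \<open>a\<close> into its levels \<open>S k = {i. k < a i}\<close>. A pair \<open>i + 2 \<le> j\<close> contributes one to
  \<open>matching_total\<close> for each level that contains both \<open>i\<close> and \<open>j\<close>, so a level of size \<open>s\<close>
  contributes \<open>s choose 2\<close> minus the number of its consecutive pairs. As \<open>S\<close> and its shift by one
  both lie in \<open>{0..t+1}\<close>, there are at least \<open>2 s - t - 2\<close> consecutive pairs, which bounds the
  contribution by \<open>level_bound t s\<close>. The key inequality (\<open>level_bound_merge\<close>) says that replacing
  two levels of sizes \<open>x\<close> and \<open>y\<close> by one of size \<open>x + y\<close>, or by a full one and one of size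
  \<open>x + y - (t + 1)\<close>, does not decrease the sum of the bounds. So the best value is that of as many
  full levels as possible and one rest (\<open>edge_bound\<close>).

  For the extremal vectors, tightness is inherited by every subfamily of the levels
  (\<open>sum_edge_bound_eq_subset\<close>). If \<open>t \<ge> 5\<close>, merging two incomplete non-empty levels is a strict gain, so
  there is at most one of them; if \<open>t = 3\<close> or \<open>t = 4\<close> there can be at most three or two, and a
  finite check finds all possibilities (\<open>tight_cases\<close>). One incomplete level, or none, means that
  the class sizes are \<open>q\<close> and \<open>q + 1\<close>; then tightness says that the large classes have as few
  consecutive pairs as possible, which is the minimality of \<open>K_value\<close>. The other possibilities are
  the patterns \<open>Pb\<close> to \<open>Pg\<close> up to reversal.

  Finally, the bound is attained by a graph whose lambda chromatic number is exactly \<open>t\<close>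
  (\<open>extremal_level_graph\<close>): a colouring with fewer colours would give a tight size vector
  with \<open>a t = 0\<close>, and by the classification there is none once \<open>n \<ge> t + 1\<close>. So having the maximum number
  of edges means having \<open>edge_bound t n\<close> edges (\<open>has_max_edges_iff\<close>), and the classification of
  tight size vectors gives the theorem.
\<close>

section \<open>The bound for size vectors\<close>

text \<open>The least number of consecutive pairs in an \<open>s\<close>-element subset of \<open>{0..t}\<close>, attained
  by \<open>crowding_attained\<close> below.\<close>

definition crowding :: "nat \<Rightarrow> nat \<Rightarrow> int" where
  "crowding t s = max 0 (2 * int s - int t - 2)"

text \<open>The largest number of pairs at distance at least two in an \<open>s\<close>-element subset of \<open>{0..t}\<close>.
  It is an integer so that the subtraction needs no side condition.\<close>

definition level_bound :: "nat \<Rightarrow> nat \<Rightarrow> int" where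
  "level_bound t s = int (s choose 2) - crowding t s"

text \<open>The total of \<open>level_bound\<close> when \<open>n\<close> is split into full levels of size \<open>t + 1\<close> and one
  remainder. The merging lemmas below show that no other split does better.\<close>

definition edge_bound :: "nat \<Rightarrow> nat \<Rightarrow> int" where
  "edge_bound t n = int (n div (t + 1)) * level_bound t (t + 1) + level_bound t (n mod (t + 1))"

definition spread_pairs :: "nat \<Rightarrow> (nat \<times> nat) set" where
  "spread_pairs t = {(i, j). i + 2 \<le> j \<and> j \<le> t}"

text \<open>The number of edges of a graph with classes of sizes \<open>a 0, \<dots>, a t\<close> in which any two
  classes with non-consecutive indices are joined by a largest possible matching.\<close>

definition matching_total :: "nat \<Rightarrow> (nat \<Rightarrow> nat) \<Rightarrow> nat" where
  "matching_total t a = (\<Sum>(i, j)\<in>spread_pairs t. min (a i) (a j))"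

lemma finite_spread_pairs: "finite (spread_pairs t)"
  by (rule finite_subset[of _ "{..t} \<times> {..t}"]) (auto simp: spread_pairs_def)

lemma min_eq_levels:
  fixes x y M :: nat
  assumes "x \<le> M"
  shows "min x y = (\<Sum>k<M. of_bool (k < x \<and> k < y))"
proof -
  have "{k. k < M \<and> k < x \<and> k < y} = {..<min x y}"
    using assms by auto
  then have "card {k. k < M \<and> k < x \<and> k < y} = min x y"
    by simp
  moreover have "(\<Sum>k<M. of_bool (k < x \<and> k < y)) = card {k. k < M \<and> k < x \<and> k < y}"
    by (auto intro!: arg_cong[where f = card])
  ultimately show ?thesis by simp
qed

lemma matching_total_levels:
  assumes "\<And>i. i \<le> t \<Longrightarrow> a i \<le> M"
  shows "matching_total t a = (\<Sum>k<M. card {(i, j) \<in> spread_pairs t. k < a i \<and> k < a j})"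
proof -
  have "matching_total t a = (\<Sum>p\<in>spread_pairs t. \<Sum>k<M. of_bool (k < a (fst p) \<and> k < a (snd p)))"
    unfolding matching_total_def case_prod_beta
    by (intro sum.cong refl min_eq_levels assms) (auto simp: spread_pairs_def)
  also have "\<dots> = (\<Sum>k<M. \<Sum>p\<in>spread_pairs t. of_bool (k < a (fst p) \<and> k < a (snd p)))"
    by (rule sum.swap)
  also have "\<dots> = (\<Sum>k<M. card {(i, j) \<in> spread_pairs t. k < a i \<and> k < a j})"
    by (intro sum.cong refl) (auto simp: finite_spread_pairs intro!: arg_cong[where f = card])
  finally show ?thesis .
qed

lemma sum_levels:
  fixes a :: "nat \<Rightarrow> nat"
  assumes "\<And>i. i \<le> t \<Longrightarrow> a i \<le> M"
  shows "(\<Sum>i\<le>t. a i) = (\<Sum>k<M. card {i. i \<le> t \<and> k < a i})"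
proof -
  have "a i = (\<Sum>k<M. of_bool (k < a i))" if "i \<le> t" for i
    using min_eq_levels[OF assms[OF that], of "a i"] by (simp only: min.idem conj_absorb)
  then have "(\<Sum>i\<le>t. a i) = (\<Sum>i\<le>t. \<Sum>k<M. of_bool (k < a i))"
    by (intro sum.cong refl) simp
  also have "\<dots> = (\<Sum>k<M. \<Sum>i\<le>t. of_bool (k < a i))"
    by (rule sum.swap)
  also have "\<dots> = (\<Sum>k<M. card {i. i \<le> t \<and> k < a i})"
    by (intro sum.cong refl) (auto intro!: arg_cong[where f = card])
  finally show ?thesis .
qed

lemma card_increasing_pairs:
  fixes S :: "nat set"
  assumes "finite S"
  shows "card {(i, j). i \<in> S \<and> j \<in> S \<and> i < j} = card S choose 2"
  using assms
proof (induction rule: finite_linorder_max_induct)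
  case empty
  then show ?case by simp
next
  case (insert b A)
  have eq: "{(i, j). i \<in> insert b A \<and> j \<in> insert b A \<and> i < j} =
      {(i, j). i \<in> A \<and> j \<in> A \<and> i < j} \<union> A \<times> {b}"
    using insert.hyps by (auto dest: less_asym)
  have fin: "finite {(i, j). i \<in> A \<and> j \<in> A \<and> i < j}"
    by (rule finite_subset[of _ "A \<times> A"]) (use insert.hyps in auto)
  have "b \<notin> A" using insert.hyps by auto
  then have "card {(i, j). i \<in> insert b A \<and> j \<in> insert b A \<and> i < j} = (card A choose 2) + card A"
    unfolding eq using insert fin
    by (subst card_Un_disjoint) (auto simp: card_cartesian_product)
  also have "\<dots> = card (insert b A) choose 2"
    using insert.hyps \<open>b \<notin> A\<close> by (simp add: numeral_2_eq_2)
  finally show ?case .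
qed

lemma card_spread_pairs_in:
  assumes "S \<subseteq> {..t}"
  shows "card {(i, j) \<in> spread_pairs t. i \<in> S \<and> j \<in> S} + card {i \<in> S. Suc i \<in> S} = card S choose 2"
proof -
  have fS: "finite S" using assms finite_subset by blast
  have eq: "{(i, j). i \<in> S \<and> j \<in> S \<and> i < j} =
      {(i, j) \<in> spread_pairs t. i \<in> S \<and> j \<in> S} \<union> (\<lambda>i. (i, Suc i)) ` {i \<in> S. Suc i \<in> S}"
    using assms by (auto simp: spread_pairs_def image_iff) (metis Suc_lessI Suc_leI)
  have fin: "finite {(i, j) \<in> spread_pairs t. i \<in> S \<and> j \<in> S}"
    by (rule finite_subset[OF _ finite_spread_pairs[of t]]) auto
  have "card S choose 2 = card {(i, j). i \<in> S \<and> j \<in> S \<and> i < j}"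
    using card_increasing_pairs[OF fS] by simp
  also have "\<dots> = card {(i, j) \<in> spread_pairs t. i \<in> S \<and> j \<in> S} +
      card ((\<lambda>i. (i, Suc i)) ` {i \<in> S. Suc i \<in> S})"
    unfolding eq using fin fS by (intro card_Un_disjoint) (auto simp: spread_pairs_def)
  also have "card ((\<lambda>i. (i, Suc i)) ` {i \<in> S. Suc i \<in> S}) = card {i \<in> S. Suc i \<in> S}"
    by (rule card_image) (auto simp: inj_on_def)
  finally show ?thesis by simp
qed

text \<open>The consecutive pairs of \<open>S\<close> are counted by the overlap of \<open>S\<close> with its shift. Both
  the lower bound on their number and its sharpness are read off from the size of the union.\<close>

lemma card_shift_union:
  fixes S :: "nat set"
  assumes fS: "finite S"
  shows "card (S \<union> Suc ` S) + card {i \<in> S. Suc i \<in> S} = 2 * card S"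
proof -
  have eq: "Suc ` {i \<in> S. Suc i \<in> S} = S \<inter> Suc ` S" by auto
  have "card (S \<union> Suc ` S) + card (S \<inter> Suc ` S) = card S + card (Suc ` S)"
    using fS by (metis card_Un_Int finite_imageI)
  then show ?thesis unfolding eq[symmetric] by (simp add: card_image)
qed

lemma crowding_le_consecutive:
  assumes "S \<subseteq> {..t}"
  shows "crowding t (card S) \<le> int (card {i \<in> S. Suc i \<in> S})"
proof -
  have fS: "finite S" using assms finite_subset by blast
  have "card (S \<union> Suc ` S) \<le> card {..t + 1}"
    by (rule card_mono) (use assms in auto)
  then show ?thesis
    using card_shift_union[OF fS] unfolding crowding_def by simp
qed

lemma level_le_bound:
  assumes "S \<subseteq> {..t}"
  shows "int (card {(i, j) \<in> spread_pairs t. i \<in> S \<and> j \<in> S}) \<le> level_bound t (card S)"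
  using card_spread_pairs_in[OF assms] crowding_le_consecutive[OF assms]
  unfolding level_bound_def by linarith

text \<open>Small sets avoid all consecutive pairs by using even numbers only. A large set is the
  complement of an initial run of odd numbers; it is optimal because together with its shift it
  covers all of \<open>{0..t+1}\<close>.\<close>

lemma crowding_attained:
  assumes "r \<le> t"
  shows "\<exists>S \<subseteq> {..t}. card S = r \<and> int (card {i \<in> S. Suc i \<in> S}) = crowding t r"
proof (cases "2 * r \<le> t + 2")
  case True
  let ?S = "(\<lambda>k. 2 * k) ` {..<r}"
  have none: "{i \<in> ?S. Suc i \<in> ?S} = {}" by auto presburger
  have sub: "?S \<subseteq> {..t}" using True by auto
  have card: "card ?S = r" by (simp add: card_image inj_on_def)
  have "int (card {i \<in> ?S. Suc i \<in> ?S}) = crowding t r"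
    unfolding none using True by (simp add: crowding_def)
  then show ?thesis using sub card by blast
next
  case False
  define m where "m = t + 1 - r"
  have m: "2 * m \<le> t" "m + r = t + 1" using False assms by (auto simp: m_def)
  let ?T = "(\<lambda>k. 2 * k + 1) ` {..<m}"
  let ?S = "{..t} - ?T"
  have T: "?T \<subseteq> {..t}" using m by auto
  have cT: "card ?T = m" by (simp add: card_image inj_on_def)
  have cS: "card ?S = r" using T cT m by (simp add: card_Diff_subset)
  have cover: "?S \<union> Suc ` ?S = {..t + 1}"
  proof (rule antisym)
    show "{..t + 1} \<subseteq> ?S \<union> Suc ` ?S"
    proof
      fix i assume i: "i \<in> {..t + 1}"
      show "i \<in> ?S \<union> Suc ` ?S"
      proof (cases "i \<in> ?S")
        case False
        then have "i \<in> ?T \<or> i = t + 1" using i by auto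
        then show ?thesis
        proof
          assume "i \<in> ?T"
          then obtain k where k: "k < m" "i = 2 * k + 1" by auto
          moreover have "2 * k \<notin> ?T" by auto presburger
          ultimately have "2 * k \<in> ?S" "i = Suc (2 * k)" using m by auto
          then show ?thesis by blast
        next
          assume "i = t + 1"
          moreover have "t \<notin> ?T" using m by auto
          ultimately have "t \<in> ?S" "i = Suc t" by auto
          then show ?thesis by blast
        qed
      qed auto
    qed
  qed auto
  have "card (?S \<union> Suc ` ?S) + card {i \<in> ?S. Suc i \<in> ?S} = 2 * card ?S"
    by (rule card_shift_union) simp
  then have "int (card {i \<in> ?S. Suc i \<in> ?S}) = crowding t r"
    unfolding cover cS using False by (simp add: crowding_def)
  then show ?thesis using cS by (intro exI[of _ ?S]) simp
qed

lemma two_times_choose_2: "2 * int (n choose 2) = int n * (int n - 1)"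
  by (induction n) (simp_all add: numeral_2_eq_2 algebra_simps)

text \<open>This is \<open>level_bound_merge\<close> in the case where the two levels overflow a full one, written in
  terms of the numbers \<open>p\<close> and \<open>q\<close> of missing elements. The product \<open>p * q\<close> is the gain of pairs, the
  maxima are the crowding terms.\<close>

lemma merge_gain:
  fixes p q t :: int
  assumes "1 \<le> p" "1 \<le> q" "p + q \<le> t + 1" "3 \<le> t"
  shows "t + max 0 (t - 2 * p - 2 * q) \<le> p * q + max 0 (t - 2 * p) + max 0 (t - 2 * q)"
    and "5 \<le> t \<Longrightarrow>
      t + max 0 (t - 2 * p - 2 * q) < p * q + max 0 (t - 2 * p) + max 0 (t - 2 * q)"
proof -
  have gain: "t + max 0 (t - 2 * p - 2 * q) \<le> p * q + max 0 (t - 2 * p) + max 0 (t - 2 * q) \<and>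
      (5 \<le> t \<longrightarrow> t + max 0 (t - 2 * p - 2 * q) < p * q + max 0 (t - 2 * p) + max 0 (t - 2 * q))"
    if "1 \<le> q" "q \<le> p" "p + q \<le> t + 1" for p q :: int
  proof -
    have pq: "p * q \<ge> 1" using that mult_mono[of 1 p 1 q] by simp
    \<comment> \<open>The cases fix which maxima vanish; in each a shifted product bounds \<open>p * q\<close> by a linear term.\<close>
    consider "2 * p + 2 * q \<le> t" | "2 * p + 2 * q > t" "2 * p \<le> t" "q = 1"
      | "2 * p + 2 * q > t" "2 * p \<le> t" "2 \<le> q" | "2 * p > t" "2 * q \<le> t" | "2 * q > t"
      using that by linarith
    then show ?thesis
    proof cases
      case 1
      then show ?thesis using that pq by auto
    next
      case 2
      then show ?thesis using that assms(4) by auto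
    next
      case 3
      have "(p - 2) * (q - 2) \<ge> 0" using 3 that by simp
      then have "p * q \<ge> 2 * p + 2 * q - 4" by (simp add: algebra_simps)
      then show ?thesis using 3 that by auto
    next
      case 4
      have "(p - 2) * q \<ge> 0" "5 \<le> t \<Longrightarrow> (p - 2) * q \<ge> 1 * 1"
        using 4 that assms(4) by (simp, intro mult_mono) auto
      then have "p * q \<ge> 2 * q" "5 \<le> t \<Longrightarrow> p * q \<ge> 2 * q + 1" by (auto simp: algebra_simps)
      then show ?thesis using 4 that by auto
    next
      case 5
      have "(p - 1) * (q - 1) \<ge> 0" "5 \<le> t \<Longrightarrow> (p - 1) * (q - 1) \<ge> 1 * 1"
        using 5 that by (simp, intro mult_mono) auto
      then have "p * q \<ge> p + q - 1" "5 \<le> t \<Longrightarrow> p * q \<ge> p + q" by (auto simp: algebra_simps)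
      then show ?thesis using 5 that by auto
    qed
  qed
  have "t + max 0 (t - 2 * p - 2 * q) \<le> p * q + max 0 (t - 2 * p) + max 0 (t - 2 * q) \<and>
      (5 \<le> t \<longrightarrow> t + max 0 (t - 2 * p - 2 * q) < p * q + max 0 (t - 2 * p) + max 0 (t - 2 * q))"
  proof (cases "q \<le> p")
    case True
    then show ?thesis using gain assms by blast
  next
    case False
    then show ?thesis using gain[of p q] assms by (simp add: mult.commute)
  qed
  then show "t + max 0 (t - 2 * p - 2 * q) \<le> p * q + max 0 (t - 2 * p) + max 0 (t - 2 * q)"
    and "5 \<le> t \<Longrightarrow>
      t + max 0 (t - 2 * p - 2 * q) < p * q + max 0 (t - 2 * p) + max 0 (t - 2 * q)"
    by auto
qed

lemma level_bound_0 [simp]: "level_bound t 0 = 0"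
  by (simp add: level_bound_def crowding_def)

lemma edge_bound_eq_level_bound: "s \<le> t + 1 \<Longrightarrow> edge_bound t s = level_bound t s"
  by (cases "s = t + 1") (simp_all add: edge_bound_def)

lemma edge_bound_add_full: "edge_bound t (q * (t + 1) + m) = int q * level_bound t (t + 1) + edge_bound t m"
proof -
  have "(q * (t + 1) + m) div (t + 1) = q + m div (t + 1)"
    by (rule div_mult_self3) simp
  moreover have "(q * (t + 1) + m) mod (t + 1) = m mod (t + 1)"
    by (rule mod_mult_self3)
  ultimately show ?thesis
    unfolding edge_bound_def by (simp add: algebra_simps)
qed

text \<open>Merging creates \<open>x * y\<close> new pairs, or as many as the product of the numbers of missing
  elements if a full level overflows, and this is at least what consecutive pairs cost. For \<open>t = 3\<close> and \<open>t = 4\<close> there are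
  ties, and these are the source of the exceptional patterns.\<close>

lemma level_bound_merge:
  assumes "3 \<le> t" "1 \<le> x" "x \<le> t" "1 \<le> y" "y \<le> t"
  shows "level_bound t x + level_bound t y \<le> edge_bound t (x + y)"
    and "5 \<le> t \<Longrightarrow> level_bound t x + level_bound t y < edge_bound t (x + y)"
proof -
  define X Y T where "X = int x" "Y = int y" "T = int t"
  note defs = this
  have "level_bound t x + level_bound t y \<le> edge_bound t (x + y) \<and>
      (5 \<le> t \<longrightarrow> level_bound t x + level_bound t y < edge_bound t (x + y))"
  proof (cases "x + y \<le> t")
    case True
    have "(X - 1) * (Y - 1) \<ge> 0" using assms by (simp add: defs)
    then have "X * Y \<ge> X + Y - 1" by (simp add: algebra_simps)
    moreover have "2 * int (x + y choose 2) = 2 * int (x choose 2) + 2 * int (y choose 2) + 2 * (X * Y)"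
      unfolding two_times_choose_2 by (simp add: defs algebra_simps)
    moreover have "crowding t (x + y) \<le> X + Y - 2"
      using True assms by (auto simp: crowding_def defs)
    moreover have "crowding t x \<ge> 0" "crowding t y \<ge> 0" by (auto simp: crowding_def)
    ultimately show ?thesis
      using True by (simp add: edge_bound_eq_level_bound level_bound_def)
  next
    case False
    define p q where "p = T + 1 - X" "q = T + 1 - Y"
    note pq = this
    have z: "int (x + y - (t + 1)) = T + 1 - p - q" using False by (simp add: pq defs)
    have split: "x + y = 1 * (t + 1) + (x + y - (t + 1))" using False by simp
    then have "edge_bound t (x + y) = level_bound t (t + 1) + edge_bound t (x + y - (t + 1))"
      using edge_bound_add_full[of t 1 "x + y - (t + 1)", folded split] by simp
    also have "\<dots> = level_bound t (t + 1) + level_bound t (x + y - (t + 1))"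
      using assms by (simp add: edge_bound_eq_level_bound)
    finally have eb: "edge_bound t (x + y) = level_bound t (t + 1) + level_bound t (x + y - (t + 1))" .
    have "2 * int (t + 1 choose 2) + 2 * int (x + y - (t + 1) choose 2) =
        2 * int (x choose 2) + 2 * int (y choose 2) + 2 * (p * q)"
      unfolding two_times_choose_2 z by (simp add: defs pq algebra_simps)
    moreover have "crowding t (t + 1) = T" by (simp add: crowding_def defs)
    moreover have "crowding t (x + y - (t + 1)) = max 0 (T - 2 * p - 2 * q)"
      unfolding crowding_def z by (simp add: defs algebra_simps)
    moreover have "crowding t x = max 0 (T - 2 * p)" "crowding t y = max 0 (T - 2 * q)"
      by (simp_all add: crowding_def defs pq algebra_simps)
    moreover have "1 \<le> p" "1 \<le> q" "p + q \<le> T + 1" "3 \<le> T"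
      using assms False by (simp_all add: pq defs)
    note merge_gain[OF this]
    ultimately show ?thesis
      unfolding eb level_bound_def using defs(3) by (cases "5 \<le> t") simp_all
  qed
  then show "level_bound t x + level_bound t y \<le> edge_bound t (x + y)"
    and "5 \<le> t \<Longrightarrow> level_bound t x + level_bound t y < edge_bound t (x + y)"
    by auto
qed

lemma edge_bound_superadditive:
  assumes "3 \<le> t"
  shows "edge_bound t m + edge_bound t n \<le> edge_bound t (m + n)"
proof -
  \<comment> \<open>Full levels split off on both sides, so only the remainders have to be merged.\<close>
  define a b where "a = m mod (t + 1)" "b = n mod (t + 1)"
  have ab: "a \<le> t" "b \<le> t" by (simp_all add: a_b_def flip: less_Suc_eq_le)
  have "m + n = (m div (t + 1) + n div (t + 1)) * (t + 1) + (a + b)"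
    using div_mult_mod_eq[of m "t + 1"] div_mult_mod_eq[of n "t + 1"]
    unfolding a_b_def distrib_right[of "m div (t + 1)"] by linarith
  then have "edge_bound t (m + n) =
      int (m div (t + 1) + n div (t + 1)) * level_bound t (t + 1) + edge_bound t (a + b)"
    by (simp only: edge_bound_add_full)
  moreover have "level_bound t a + level_bound t b \<le> edge_bound t (a + b)"
  proof (cases "a = 0 \<or> b = 0")
    case True
    then show ?thesis using ab by (auto simp: edge_bound_eq_level_bound)
  next
    case False
    then show ?thesis using ab assms level_bound_merge(1) by simp
  qed
  ultimately show ?thesis
    by (simp add: edge_bound_def a_b_def algebra_simps)
qed

lemma sum_edge_bound_le:
  assumes "3 \<le> t" "finite K"
  shows "(\<Sum>k\<in>K. edge_bound t (s k)) \<le> edge_bound t (\<Sum>k\<in>K. s k)"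
  using assms(2)
proof (induction rule: finite_induct)
  case empty
  then show ?case by (simp add: edge_bound_def)
next
  case (insert x F)
  then show ?case using edge_bound_superadditive[OF assms(1), of "s x" "sum s F"] by simp
qed

text \<open>If a family is tight then so is each subfamily: otherwise replacing the subfamily by its best
  split would beat the bound for the whole family. Testing small subfamilies therefore restricts
  the whole.\<close>

lemma sum_edge_bound_eq_subset:
  assumes "3 \<le> t" "finite K" "A \<subseteq> K"
    and "edge_bound t (\<Sum>k\<in>K. s k) \<le> (\<Sum>k\<in>K. edge_bound t (s k))"
  shows "(\<Sum>k\<in>A. edge_bound t (s k)) = edge_bound t (\<Sum>k\<in>A. s k)"
proof -
  have fin: "finite A" "finite (K - A)" using assms finite_subset by auto
  have "sum s K = sum s (K - A) + sum s A"
    "(\<Sum>k\<in>K. edge_bound t (s k)) = (\<Sum>k\<in>K - A. edge_bound t (s k)) + (\<Sum>k\<in>A. edge_bound t (s k))"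
    using assms by (auto intro: sum.subset_diff)
  then show ?thesis
    using assms(4) sum_edge_bound_le[OF assms(1) fin(1), of s]
      sum_edge_bound_le[OF assms(1) fin(2), of s]
      edge_bound_superadditive[OF assms(1), of "sum s (K - A)" "sum s A"]
    by simp
qed

lemma card_spread_pairs: "int (card (spread_pairs t)) = level_bound t (t + 1)"
proof -
  have "{(i, j) \<in> spread_pairs t. i \<in> {..t} \<and> j \<in> {..t}} = spread_pairs t"
    by (auto simp: spread_pairs_def)
  moreover have "{i \<in> {..t}. Suc i \<in> {..t}} = {..<t}" by auto
  ultimately show ?thesis
    using card_spread_pairs_in[of "{..t}" t] by (simp add: level_bound_def crowding_def)
qed

text \<open>Raising all classes by \<open>q\<close> adds \<open>q\<close> full levels, both here and in the bound (next lemma),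
  so tightness depends only on the vector above its minimum.\<close>

lemma matching_total_shift:
  assumes "\<And>i. i \<le> t \<Longrightarrow> a i = q + b i"
  shows "int (matching_total t a) = int q * level_bound t (t + 1) + int (matching_total t b)"
proof -
  have "matching_total t a = (\<Sum>(i, j)\<in>spread_pairs t. q + min (b i) (b j))"
    unfolding matching_total_def using assms
    by (intro sum.cong refl) (auto simp: spread_pairs_def min_add_distrib_right)
  also have "\<dots> = card (spread_pairs t) * q + matching_total t b"
    by (simp add: matching_total_def sum.distrib case_prod_beta)
  finally show ?thesis unfolding card_spread_pairs[symmetric] by simp
qed

lemma edge_bound_shift:
  assumes "\<And>i. i \<le> t \<Longrightarrow> a i = q + b i"
  shows "edge_bound t (\<Sum>i\<le>t. a i) = int q * level_bound t (t + 1) + edge_bound t (\<Sum>i\<le>t. b i)"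
proof -
  have "(\<Sum>i\<le>t. a i) = (\<Sum>i\<le>t. q + b i)" using assms by (intro sum.cong) auto
  also have "\<dots> = q * (t + 1) + (\<Sum>i\<le>t. b i)" by (simp add: sum.distrib)
  finally show ?thesis by (simp only: edge_bound_add_full)
qed

text \<open>The second part passes tightness from the vector to an arbitrary set of its non-empty
  levels; it is the tool that limits how many incomplete levels there are.\<close>

lemma matching_total_le_edge_bound:
  assumes "3 \<le> t"
  shows "int (matching_total t a) \<le> edge_bound t (\<Sum>i\<le>t. a i)"
    and "\<lbrakk>int (matching_total t a) = edge_bound t (\<Sum>i\<le>t. a i);
          \<And>k. k \<in> K \<Longrightarrow> \<exists>j\<le>t. k < a j\<rbrakk> \<Longrightarrow>
        (\<Sum>k\<in>K. edge_bound t (card {i. i \<le> t \<and> k < a i})) =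
          edge_bound t (\<Sum>k\<in>K. card {i. i \<le> t \<and> k < a i})"
proof -
  define M where "M = (\<Sum>i\<le>t. a i)"
  have M: "a i \<le> M" if "i \<le> t" for i
    unfolding M_def using that by (intro member_le_sum) auto
  define s where "s k = card {i. i \<le> t \<and> k < a i}" for k
  have s: "s k \<le> t + 1" for k
    unfolding s_def using card_mono[of "{..t}" "{i. i \<le> t \<and> k < a i}"] by auto
  have total: "(\<Sum>i\<le>t. a i) = (\<Sum>k<M. s k)"
    unfolding s_def by (rule sum_levels) (rule M)
  have "int (card {(i, j) \<in> spread_pairs t. k < a i \<and> k < a j}) \<le> edge_bound t (s k)" for k
  proof -
    have "{(i, j) \<in> spread_pairs t. k < a i \<and> k < a j} = {(i, j) \<in> spread_pairs t.
        i \<in> {i. i \<le> t \<and> k < a i} \<and> j \<in> {i. i \<le> t \<and> k < a i}}"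
      by (auto simp: spread_pairs_def)
    then show ?thesis
      using level_le_bound[of "{i. i \<le> t \<and> k < a i}" t] s[of k]
      by (auto simp: edge_bound_eq_level_bound s_def)
  qed
  then have le: "int (matching_total t a) \<le> (\<Sum>k<M. edge_bound t (s k))"
    by (subst matching_total_levels[of t a M]) (simp_all add: M sum_mono)
  also have "\<dots> \<le> edge_bound t (\<Sum>i\<le>t. a i)"
    unfolding total by (rule sum_edge_bound_le) (use assms in auto)
  finally show "int (matching_total t a) \<le> edge_bound t (\<Sum>i\<le>t. a i)" .
  assume "int (matching_total t a) = edge_bound t (\<Sum>i\<le>t. a i)"
    and K: "\<And>k. k \<in> K \<Longrightarrow> \<exists>j\<le>t. k < a j"
  have "K \<subseteq> {..<M}"
  proof
    fix k assume "k \<in> K"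
    then obtain j where "j \<le> t" "k < a j" using K by blast
    then show "k \<in> {..<M}" using M[of j] by simp
  qed
  moreover have "edge_bound t (\<Sum>k<M. s k) \<le> (\<Sum>k<M. edge_bound t (s k))"
    using le \<open>int (matching_total t a) = _\<close> unfolding total by simp
  ultimately show "(\<Sum>k\<in>K. edge_bound t (card {i. i \<le> t \<and> k < a i})) =
      edge_bound t (\<Sum>k\<in>K. card {i. i \<le> t \<and> k < a i})"
    unfolding s_def[symmetric] by (intro sum_edge_bound_eq_subset[OF assms]) auto
qed

section \<open>Classification of the extremal size vectors\<close>

text \<open>The exceptional size patterns as conditions on numbers: \<open>lopsided3\<close> collects \<open>Pb\<close> to \<open>Pe\<close>,
  \<open>lopsided4\<close> collects \<open>Pf\<close> and \<open>Pg\<close>, and \<open>lopsided\<close> adds their mirror images, which come from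
  the dual partition. The pattern \<open>Ph\<close> is not extremal: it has two incomplete levels of size
  four, and merging these is a strict gain.\<close>

definition lopsided3 :: "nat \<Rightarrow> nat \<Rightarrow> nat \<Rightarrow> nat \<Rightarrow> bool" where
  "lopsided3 w x y z \<longleftrightarrow>
     w = x + 1 \<and> x + 1 = y + 2 \<and> y + 2 = z \<or> w + 1 = x \<and> x = y + 2 \<and> y + 2 = z \<or>
     w = x + 2 \<and> x + 2 = y \<and> y = z \<or> w = x + 3 \<and> x + 3 = y \<and> y = z"

definition lopsided4 :: "nat \<Rightarrow> nat \<Rightarrow> nat \<Rightarrow> nat \<Rightarrow> nat \<Rightarrow> bool" where
  "lopsided4 v w x y z \<longleftrightarrow>
     v = w + 2 \<and> w + 2 = x \<and> x = y + 1 \<and> y + 1 = z \<or> v = w + 2 \<and> w + 2 = x \<and> x = y + 2 \<and> y + 2 = z"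

definition lopsided :: "nat \<Rightarrow> (nat \<Rightarrow> nat) \<Rightarrow> bool" where
  "lopsided t a \<longleftrightarrow>
     t = 3 \<and> (lopsided3 (a 0) (a 1) (a 2) (a 3) \<or> lopsided3 (a 3) (a 2) (a 1) (a 0)) \<or>
     t = 4 \<and> (lopsided4 (a 0) (a 1) (a 2) (a 3) (a 4) \<or> lopsided4 (a 4) (a 3) (a 2) (a 1) (a 0))"

lemma matching_total_3:
  "matching_total 3 a = min (a 0) (a 2) + min (a 0) (a 3) + min (a 1) (a 3)"
proof -
  have "spread_pairs 3 = {(0, 2), (0, 3), (1, 3)}"
    by (auto simp: spread_pairs_def)
  then show ?thesis by (simp add: matching_total_def)
qed

lemma matching_total_4:
  "matching_total 4 a = min (a 0) (a 2) + min (a 0) (a 3) + min (a 0) (a 4) +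
     min (a 1) (a 3) + min (a 1) (a 4) + min (a 2) (a 4)"
proof -
  have "spread_pairs 4 = {(0, 2), (0, 3), (0, 4), (1, 3), (1, 4), (2, 4)}"
    by (auto simp: spread_pairs_def)
  then show ?thesis by (simp add: matching_total_def)
qed

lemma edge_bound_3: "edge_bound 3 n = int (3 * (n div 4) + (n mod 4 - 1))"
proof -
  have "n mod 4 < 4" by simp
  then consider "n mod 4 = 0" | "n mod 4 = 1" | "n mod 4 = 2" | "n mod 4 = 3" by linarith
  then show ?thesis
    by cases (simp_all add: edge_bound_def level_bound_def crowding_def choose_two)
qed

lemma edge_bound_4: "edge_bound 4 n = int (6 * (n div 5) + (n mod 5 - 1) + of_bool (n mod 5 \<ge> 3))"
proof -
  have "n mod 5 < 5" by simp
  then consider "n mod 5 = 0" | "n mod 5 = 1" | "n mod 5 = 2" | "n mod 5 = 3" | "n mod 5 = 4"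
    by linarith
  then show ?thesis
    by cases (simp_all add: edge_bound_def level_bound_def crowding_def choose_two)
qed

lemma sum_to_3: "(\<Sum>i\<le>(3::nat). a i) = a 0 + a 1 + a 2 + (a 3 :: nat)"
  by (simp add: numeral_eq_Suc)

lemma sum_to_4: "(\<Sum>i\<le>(4::nat). a i) = a 0 + a 1 + a 2 + a 3 + (a 4 :: nat)"
  by (simp add: numeral_eq_Suc)

lemma lopsided3_cases:
  assumes "lopsided3 w x y z"
  obtains "w = y + 2" "x = y + 1" "z = y + 2" | "w = y + 1" "x = y + 2" "z = y + 2"
    | "w = x + 2" "y = x + 2" "z = x + 2" | "w = x + 3" "y = x + 3" "z = x + 3"
  using assms unfolding lopsided3_def by linarith

lemma lopsided4_cases:
  assumes "lopsided4 v w x y z"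
  obtains "v = w + 2" "x = w + 2" "y = w + 1" "z = w + 2" | "v = w + 2" "x = w + 2" "y = w" "z = w + 2"
  using assms unfolding lopsided4_def by linarith

lemma lopsided3_sum:
  assumes "lopsided3 w x y z"
  shows "min w y + min w z + min x z = 3 * ((w + x + y + z) div 4) + ((w + x + y + z) mod 4 - 1)"
  using assms by (cases rule: lopsided3_cases) (simp; presburger)+
lemma lopsided4_sum:
  assumes "lopsided4 v w x y z"
  shows "min v x + min v y + min v z + min w y + min w z + min x z =
       6 * ((v + w + x + y + z) div 5) + ((v + w + x + y + z) mod 5 - 1) +
       of_bool ((v + w + x + y + z) mod 5 \<ge> 3)"
  using assms by (cases rule: lopsided4_cases) (simp; presburger)+

lemma lopsided_tight:
  assumes "lopsided t a"
  shows "int (matching_total t a) = edge_bound t (\<Sum>i\<le>t. a i)"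
proof -
  consider "t = 3" | "t = 4" using assms by (auto simp: lopsided_def)
  then show ?thesis
  proof cases
    case 1
    with assms have "lopsided3 (a 0) (a 1) (a 2) (a 3) \<or> lopsided3 (a 3) (a 2) (a 1) (a 0)"
      by (simp add: lopsided_def)
    then show ?thesis unfolding 1 matching_total_3 edge_bound_3 sum_to_3
      by (auto dest!: lopsided3_sum simp only: min.commute add_ac)
  next
    case 2
    with assms have "lopsided4 (a 0) (a 1) (a 2) (a 3) (a 4) \<or> lopsided4 (a 4) (a 3) (a 2) (a 1) (a 0)"
      by (simp add: lopsided_def)
    then show ?thesis unfolding 2 matching_total_4 edge_bound_4 sum_to_4
      by (auto dest!: lopsided4_sum simp only: min.commute add_ac)
  qed
qed

text \<open>There are at most three incomplete levels (two for \<open>t = 4\<close>), so after subtracting the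
  minimum the entries are below four (three), and running through all vectors settles the matter.\<close>

lemma tight_small_3:
  "\<forall>w\<in>set [0..<4]. \<forall>x\<in>set [0..<4]. \<forall>y\<in>set [0..<4]. \<forall>z\<in>set [0..<4].
     min w y + min w z + min x z = 3 * ((w + x + y + z) div 4) + ((w + x + y + z) mod 4 - 1) \<longrightarrow>
     (\<exists>q\<in>set [0..<4]. list_all (\<lambda>v. v = q \<or> v = q + 1) [w, x, y, z]) \<or>
     lopsided3 w x y z \<or> lopsided3 z y x w"
  by code_simp

lemma tight_small_4:
  "\<forall>v\<in>set [0..<3]. \<forall>w\<in>set [0..<3]. \<forall>x\<in>set [0..<3]. \<forall>y\<in>set [0..<3]. \<forall>z\<in>set [0..<3].
     min v x + min v y + min v z + min w y + min w z + min x z =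
       6 * ((v + w + x + y + z) div 5) + ((v + w + x + y + z) mod 5 - 1) +
       of_bool ((v + w + x + y + z) mod 5 \<ge> 3) \<longrightarrow>
     (\<exists>q\<in>set [0..<3]. list_all (\<lambda>u. u = q \<or> u = q + 1) [v, w, x, y, z]) \<or>
     lopsided4 v w x y z \<or> lopsided4 z y x w v"
  by code_simp

text \<open>For \<open>t = 3\<close>, four incomplete levels always admit a profitable merge, so in a tight vector
  there are at most three; for \<open>t = 4\<close> already three admit one.\<close>

lemma no_four_tight_levels_3:
  "\<forall>w\<in>set [1..<4]. \<forall>x\<in>set [1..<4]. \<forall>y\<in>set [1..<4]. \<forall>z\<in>set [1..<4].
     edge_bound 3 w + (edge_bound 3 x + (edge_bound 3 y + edge_bound 3 z)) \<noteq>
     edge_bound 3 (w + (x + (y + z)))"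
  unfolding edge_bound_3 of_nat_add[symmetric] of_nat_eq_iff by code_simp

lemma no_three_tight_levels_4:
  "\<forall>x\<in>set [1..<5]. \<forall>y\<in>set [1..<5]. \<forall>z\<in>set [1..<5].
     edge_bound 4 x + (edge_bound 4 y + edge_bound 4 z) \<noteq> edge_bound 4 (x + (y + z))"
  unfolding edge_bound_4 of_nat_add[symmetric] of_nat_eq_iff by code_simp

text \<open>The largest number of incomplete non-empty levels that a tight size vector can have.\<close>

definition level_depth :: "nat \<Rightarrow> nat" where
  "level_depth t = (if t = 3 then 3 else if t = 4 then 2 else 1)"

text \<open>The levels between the smallest and the largest entry are non-empty and incomplete. If there
  were more than \<open>level_depth t\<close> of them, the lowest \<open>level_depth t + 1\<close> would form a tight family
  that can be merged with a strict gain.\<close>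

lemma tight_level_depth:
  assumes t: "3 \<le> t" and tight: "int (matching_total t a) = edge_bound t (\<Sum>i\<le>t. a i)"
  obtains q b where "\<And>i. i \<le> t \<Longrightarrow> a i = q + b i" "\<And>i. i \<le> t \<Longrightarrow> b i \<le> level_depth t"
proof -
  define q where "q = Min (a ` {..t})"
  have q: "q \<le> a i" if "i \<le> t" for i unfolding q_def using that by auto
  have "q \<in> a ` {..t}" unfolding q_def by (rule Min_in) auto
  then obtain i0 where i0: "i0 \<le> t" "a i0 = q" by auto
  define s where "s k = card {i. i \<le> t \<and> k < a i}" for k
  have "a i \<le> q + level_depth t" if i: "i \<le> t" for i
  proof (rule ccontr)
    assume "\<not> a i \<le> q + level_depth t"
    then have big: "q + level_depth t < a i" by simp
    have partial: "1 \<le> s k \<and> s k \<le> t" if "k \<in> {q..q + level_depth t}" for k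
    proof
      have "{i} \<subseteq> {i. i \<le> t \<and> k < a i}" using i big that by auto
      then show "1 \<le> s k" unfolding s_def using card_mono[of "{i. i \<le> t \<and> k < a i}" "{i}"] by simp
      have "{i. i \<le> t \<and> k < a i} \<subseteq> {..t} - {i0}" using i0 that by auto
      then show "s k \<le> t"
        unfolding s_def using card_mono[of "{..t} - {i0}" "{i. i \<le> t \<and> k < a i}"] i0 by simp
    qed
    have eq: "(\<Sum>k\<in>{q..q + level_depth t}. edge_bound t (s k)) =
        edge_bound t (\<Sum>k\<in>{q..q + level_depth t}. s k)"
      unfolding s_def
      by (rule matching_total_le_edge_bound(2)[OF t tight]) (use big i in force)
    consider "t = 3" | "t = 4" | "5 \<le> t" using t by linarith
    then show False
    proof cases
      case 1
      have K: "{q..q + level_depth t} = {q, q + 1, q + 2, q + 3}"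
        using 1 by (auto simp: level_depth_def)
      have "s k \<in> set [1..<4]" if "k \<in> {q, q + 1, q + 2, q + 3}" for k
        using partial[of k] that 1 unfolding K by auto
      then have "edge_bound 3 (s q) + (edge_bound 3 (s (q + 1)) + (edge_bound 3 (s (q + 2)) +
          edge_bound 3 (s (q + 3)))) \<noteq> edge_bound 3 (s q + (s (q + 1) + (s (q + 2) + s (q + 3))))"
        using no_four_tight_levels_3 by blast
      then show False using eq unfolding K unfolding 1 by simp
    next
      case 2
      have K: "{q..q + level_depth t} = {q, q + 1, q + 2}"
        using 2 by (auto simp: level_depth_def)
      have "s k \<in> set [1..<5]" if "k \<in> {q, q + 1, q + 2}" for k
        using partial[of k] that 2 unfolding K by auto
      then have "edge_bound 4 (s q) + (edge_bound 4 (s (q + 1)) + edge_bound 4 (s (q + 2))) \<noteq>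
          edge_bound 4 (s q + (s (q + 1) + s (q + 2)))"
        using no_three_tight_levels_4 by blast
      then show False using eq unfolding K unfolding 2 by simp
    next
      case 3
      have K: "{q..q + level_depth t} = {q, q + 1}"
        using 3 by (auto simp: level_depth_def)
      then show False
        using eq partial[of q] partial[of "q + 1"] level_bound_merge(2)[OF t, of "s q" "s (q + 1)"] 3
        unfolding K by (simp add: edge_bound_eq_level_bound)
    qed
  qed
  then have "a i = q + (a i - q) \<and> a i - q \<le> level_depth t" if "i \<le> t" for i
    using q[OF that] that by fastforce
  then show ?thesis by (intro that[of q "\<lambda>i. a i - q"]) auto
qed

text \<open>Subtracting the minimum leaves finitely many vectors for \<open>t = 3\<close> and \<open>t = 4\<close>, and a vector
  of zeros and ones for \<open>t \<ge> 5\<close>.\<close>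

lemma tight_cases:
  assumes t: "3 \<le> t" and tight: "int (matching_total t a) = edge_bound t (\<Sum>i\<le>t. a i)"
  shows "(\<exists>q. \<forall>i\<le>t. a i = q \<or> a i = q + 1) \<or> lopsided t a"
proof -
  obtain q b where b: "\<And>i. i \<le> t \<Longrightarrow> a i = q + b i" "\<And>i. i \<le> t \<Longrightarrow> b i \<le> level_depth t"
    using tight_level_depth[OF t tight] by metis
  have tight_b: "int (matching_total t b) = edge_bound t (\<Sum>i\<le>t. b i)"
    using tight matching_total_shift[of t a q b] edge_bound_shift[of t a q b] b(1) by simp
  consider "t = 3" | "t = 4" | "5 \<le> t" using t by linarith
  then have "(\<exists>p. \<forall>i\<le>t. b i = p \<or> b i = p + 1) \<or> lopsided t b"
  proof cases
    case 1
    have "b i \<in> set [0..<4]" if "i \<le> 3" for i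
      using b(2)[of i] that 1 by (auto simp: level_depth_def)
    from this[of 0] this[of 1] this[of 2] this[of 3]
    have mem: "b 0 \<in> set [0..<4]" "b 1 \<in> set [0..<4]" "b 2 \<in> set [0..<4]" "b 3 \<in> set [0..<4]"
      by simp_all
    have eq: "min (b 0) (b 2) + min (b 0) (b 3) + min (b 1) (b 3) =
        3 * ((b 0 + b 1 + b 2 + b 3) div 4) + ((b 0 + b 1 + b 2 + b 3) mod 4 - 1)"
      using tight_b unfolding 1 matching_total_3 edge_bound_3 sum_to_3 by (simp only: of_nat_eq_iff)
    from tight_small_3[rule_format, OF mem eq]
    consider p where "list_all (\<lambda>v. v = p \<or> v = p + 1) [b 0, b 1, b 2, b 3]"
      | "lopsided3 (b 0) (b 1) (b 2) (b 3) \<or> lopsided3 (b 3) (b 2) (b 1) (b 0)" by blast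
    then show ?thesis
    proof cases
      case (1 p)
      have "b i = p \<or> b i = p + 1" if "i \<le> t" for i
      proof -
        have "i = 0 \<or> i = 1 \<or> i = 2 \<or> i = 3" using that \<open>t = 3\<close> by linarith
        then show ?thesis by (elim disjE) (use 1 in simp_all)
      qed
      then show ?thesis by blast
    next
      case 2
      then show ?thesis using \<open>t = 3\<close> by (simp add: lopsided_def)
    qed
  next
    case 2
    have "b i \<in> set [0..<3]" if "i \<le> 4" for i
      using b(2)[of i] that 2 by (auto simp: level_depth_def)
    from this[of 0] this[of 1] this[of 2] this[of 3] this[of 4]
    have mem: "b 0 \<in> set [0..<3]" "b 1 \<in> set [0..<3]" "b 2 \<in> set [0..<3]" "b 3 \<in> set [0..<3]" "b 4 \<in> set [0..<3]"
      by simp_all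
    have eq: "min (b 0) (b 2) + min (b 0) (b 3) + min (b 0) (b 4) +
        min (b 1) (b 3) + min (b 1) (b 4) + min (b 2) (b 4) =
        6 * ((b 0 + b 1 + b 2 + b 3 + b 4) div 5) + ((b 0 + b 1 + b 2 + b 3 + b 4) mod 5 - 1) +
        of_bool ((b 0 + b 1 + b 2 + b 3 + b 4) mod 5 \<ge> 3)"
      using tight_b unfolding 2 matching_total_4 edge_bound_4 sum_to_4 by (simp only: of_nat_eq_iff)
    from tight_small_4[rule_format, OF mem eq]
    consider p where "list_all (\<lambda>v. v = p \<or> v = p + 1) [b 0, b 1, b 2, b 3, b 4]"
      | "lopsided4 (b 0) (b 1) (b 2) (b 3) (b 4) \<or> lopsided4 (b 4) (b 3) (b 2) (b 1) (b 0)" by blast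
    then show ?thesis
    proof cases
      case (1 p)
      have "b i = p \<or> b i = p + 1" if "i \<le> t" for i
      proof -
        have "i = 0 \<or> i = 1 \<or> i = 2 \<or> i = 3 \<or> i = 4" using that \<open>t = 4\<close> by linarith
        then show ?thesis by (elim disjE) (use 1 in simp_all)
      qed
      then show ?thesis by blast
    next
      case 2
      then show ?thesis using \<open>t = 4\<close> by (simp add: lopsided_def)
    qed
  next
    case 3
    have "b i = 0 \<or> b i = 0 + 1" if "i \<le> t" for i
      using b(2)[OF that] 3 by (auto simp: level_depth_def)
    then show ?thesis by blast
  qed
  then show ?thesis
  proof
    assume "\<exists>p. \<forall>i\<le>t. b i = p \<or> b i = p + 1"
    then obtain p where p: "\<And>i. i \<le> t \<Longrightarrow> b i = p \<or> b i = p + 1" by blast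
    have "a i = q + p \<or> a i = q + p + 1" if "i \<le> t" for i
      using b(1)[OF that] p[OF that] by linarith
    then show ?thesis by blast
  next
    assume "lopsided t b"
    moreover have "lopsided3 (q + w) (q + x) (q + y) (q + z) = lopsided3 w x y z" for w x y z
      by (simp only: lopsided3_def add.assoc add_left_cancel)
    moreover have "lopsided4 (q + v) (q + w) (q + x) (q + y) (q + z) = lopsided4 v w x y z" for v w x y z
      by (simp only: lopsided4_def add.assoc add_left_cancel)
    moreover have "t = 3 \<Longrightarrow> a 0 = q + b 0 \<and> a 1 = q + b 1 \<and> a 2 = q + b 2 \<and> a 3 = q + b 3"
      "t = 4 \<Longrightarrow> a 0 = q + b 0 \<and> a 1 = q + b 1 \<and> a 2 = q + b 2 \<and> a 3 = q + b 3 \<and> a 4 = q + b 4"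
      using b(1) by simp_all
    ultimately have "lopsided t a"
      unfolding lopsided_def by (elim disjE conjE) simp_all
    then show ?thesis by blast
  qed
qed

lemma matching_total_of_bool:
  assumes "S \<subseteq> {..t}"
  shows "int (matching_total t (\<lambda>i. of_bool (i \<in> S))) =
    int (card S choose 2) - int (card {i \<in> S. Suc i \<in> S})"
proof -
  have "matching_total t (\<lambda>i. of_bool (i \<in> S)) =
      (\<Sum>p\<in>spread_pairs t. of_bool (fst p \<in> S \<and> snd p \<in> S))"
    unfolding matching_total_def by (intro sum.cong) auto
  also have "\<dots> = card {(i, j) \<in> spread_pairs t. i \<in> S \<and> j \<in> S}"
    using finite_spread_pairs by (auto intro!: arg_cong[where f = card])
  finally show ?thesis using card_spread_pairs_in[OF assms] by simp
qed

text \<open>Above the full levels only the set \<open>S\<close> of large classes is left, so tightness is optimality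
  of this single level.\<close>

lemma two_level_tight_iff:
  assumes S: "S \<subseteq> {..t}" "card S \<le> t" and a: "\<And>i. i \<le> t \<Longrightarrow> a i = q + of_bool (i \<in> S)"
  shows "(\<Sum>i\<le>t. a i) = q * (t + 1) + card S"
    and "int (matching_total t a) = edge_bound t (\<Sum>i\<le>t. a i) \<longleftrightarrow>
      int (card {i \<in> S. Suc i \<in> S}) = crowding t (card S)"
proof -
  have card: "(\<Sum>i\<le>t. of_bool (i \<in> S)) = card S"
    using S by (simp add: Int_absorb1 Int_absorb2)
  have "(\<Sum>i\<le>t. a i) = (\<Sum>i\<le>t. q + of_bool (i \<in> S))" using a by (intro sum.cong) auto
  then show "(\<Sum>i\<le>t. a i) = q * (t + 1) + card S" using card by (simp add: sum.distrib)
  show "int (matching_total t a) = edge_bound t (\<Sum>i\<le>t. a i) \<longleftrightarrow>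
      int (card {i \<in> S. Suc i \<in> S}) = crowding t (card S)"
    using matching_total_shift[of t a q "\<lambda>i. of_bool (i \<in> S)"] a
      edge_bound_shift[of t a q "\<lambda>i. of_bool (i \<in> S)"] matching_total_of_bool[OF S(1)] S(2)
    unfolding card by (simp add: edge_bound_eq_level_bound level_bound_def)
qed

text \<open>Positivity of the two end entries yields the colour range and hence the lambda chromatic
  number of the extremal graphs; the third part is the condition on empty classes in the definition
  of a stationary graph.\<close>

lemma tight_ends:
  assumes t: "3 \<le> t" and tight: "int (matching_total t a) = edge_bound t (\<Sum>i\<le>t. a i)"
    and n: "t + 1 \<le> (\<Sum>i\<le>t. a i)"
  shows "0 < a 0" "0 < a t" "i < t \<Longrightarrow> 0 < a i \<or> 0 < a (i + 1)"
proof -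
  have "0 < a 0 \<and> 0 < a t \<and> (\<forall>i<t. 0 < a i \<or> 0 < a (i + 1))"
    using tight_cases[OF t tight]
  proof
    assume "\<exists>q. \<forall>i\<le>t. a i = q \<or> a i = q + 1"
    then obtain q where q: "\<And>i. i \<le> t \<Longrightarrow> a i = q \<or> a i = q + 1" by blast
    have "0 < a i" if "i \<le> t" for i
    proof (rule ccontr)
      assume "\<not> 0 < a i"
      then have "a i = 0" "q = 0" using q[OF that] by auto
      \<comment> \<open>An empty class forces \<open>q = 0\<close>, so all classes have at most one element.\<close>
      then have "(\<Sum>j\<le>t. a j) \<le> (\<Sum>j\<le>t. of_bool (j \<noteq> i))"
        using q by (intro sum_mono) force
      also have "\<dots> = card ({..t} - {i})"
        by (simp add: Collect_neg_eq flip: Diff_eq)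
      finally show False using n that by simp
    qed
    then show ?thesis by simp
  next
    assume "lopsided t a"
    then consider "t = 3" "lopsided3 (a 0) (a 1) (a 2) (a 3) \<or> lopsided3 (a 3) (a 2) (a 1) (a 0)"
      | "t = 4" "lopsided4 (a 0) (a 1) (a 2) (a 3) (a 4) \<or> lopsided4 (a 4) (a 3) (a 2) (a 1) (a 0)"
      unfolding lopsided_def by blast
    then show ?thesis
    proof cases
      case 1
      \<comment> \<open>Only an inner class can be empty, and it lies next to non-empty ones.\<close>
      have "i = 0 \<or> i = 1 \<or> i = 2" if "i < t" for i using that 1(1) by linarith
      moreover have "0 < a 0 \<and> 0 < a 3 \<and> (0 < a 1 \<or> 0 < a 2)"
        using 1(2) unfolding lopsided3_def by linarith
      moreover have "i + 1 = 3" if "i = 2" for i :: nat using that by simp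
      ultimately show ?thesis using 1(1) by (metis add_0 nat_1_add_1)
    next
      case 2
      have "i = 0 \<or> i = 1 \<or> i = 2 \<or> i = 3" if "i < t" for i using that 2(1) by linarith
      moreover have "0 < a 0 \<and> 0 < a 4 \<and> 0 < a 2"
        using 2(2) unfolding lopsided4_def by linarith
      moreover have "i + 1 = 4" if "i = 3" for i :: nat using that by simp
      ultimately show ?thesis using 2(1) by (metis add_0 nat_1_add_1)
    qed
  qed
  then show "0 < a 0" "0 < a t" "i < t \<Longrightarrow> 0 < a i \<or> 0 < a (i + 1)" by auto
qed

lemma lopsided_mod:
  assumes "lopsided t a"
  shows "(\<Sum>i\<le>t. a i) mod (t + 1) \<noteq> 0"
proof -
  consider "t = 3" "lopsided3 (a 0) (a 1) (a 2) (a 3) \<or> lopsided3 (a 3) (a 2) (a 1) (a 0)"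
    | "t = 4" "lopsided4 (a 0) (a 1) (a 2) (a 3) (a 4) \<or> lopsided4 (a 4) (a 3) (a 2) (a 1) (a 0)"
    using assms unfolding lopsided_def by blast
  then show ?thesis
  proof cases
    case 1
    have "(w + x + y + z) mod 4 \<noteq> 0" if "lopsided3 w x y z" for w x y z
      using that by (cases rule: lopsided3_cases) (simp; presburger)+
    from this[of "a 0" "a 1" "a 2" "a 3"] this[of "a 3" "a 2" "a 1" "a 0"]
    show ?thesis using 1 by (auto simp: sum_to_3 add_ac)
  next
    case 2
    have "(v + w + x + y + z) mod 5 \<noteq> 0" if "lopsided4 v w x y z" for v w x y z
      using that by (cases rule: lopsided4_cases) (simp; presburger)+
    from this[of "a 0" "a 1" "a 2" "a 3" "a 4"] this[of "a 4" "a 3" "a 2" "a 1" "a 0"]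
    show ?thesis using 2 by (auto simp: sum_to_4 add_ac)
  qed
qed

text \<open>With at most two consecutive values, the sizes are determined by the sum up to the choice of
  the set of large classes. If all entries are \<open>q + 1\<close>, this set is empty, not everything.\<close>

lemma two_level_form:
  assumes "\<And>i. i \<le> t \<Longrightarrow> a i = q \<or> a i = q + (1::nat)" and n: "(\<Sum>i\<le>t. a i) = n"
  obtains S where "S \<subseteq> {..t}" "card S = n mod (t + 1)"
    "\<And>i. i \<le> t \<Longrightarrow> a i = n div (t + 1) + of_bool (i \<in> S)"
proof (cases "\<forall>i\<le>t. a i = q + 1")
  case True
  then have "n = (q + 1) * (t + 1)" using n by (simp add: algebra_simps)
  then have "n div (t + 1) = q + 1" "n mod (t + 1) = 0" by (simp_all del: mult_Suc mult_Suc_right)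
  then show ?thesis using True by (intro that[of "{}"]) auto
next
  case False
  define S where "S = {i. i \<le> t \<and> a i = q + 1}"
  have S: "S \<subset> {..t}" using False by (auto simp: S_def)
  then have cS: "card S \<le> t" using psubset_card_mono[OF _ S] by simp
  have a: "a i = q + of_bool (i \<in> S)" if "i \<le> t" for i using assms(1)[OF that] that by (auto simp: S_def)
  have "n = q * (t + 1) + card S" using two_level_tight_iff(1)[OF _ cS a] S n by auto
  then have "n div (t + 1) = q" "n mod (t + 1) = card S"
    using cS by (simp_all del: mult_Suc mult_Suc_right)
  then show ?thesis using S a by (intro that[of S]) auto
qed

section \<open>Graphs with matched layers\<close>

lemma simple_graphD:
  assumes "simple_graph G"
  shows "finite (pverts G)" "pverts G \<noteq> {}" "parcs G \<subseteq> pverts G \<times> pverts G" "finite (parcs G)"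
    "(x, y) \<in> parcs G \<Longrightarrow> (y, x) \<in> parcs G" "(x, y) \<in> parcs G \<Longrightarrow> x \<noteq> y"
    "wf_digraph (with_proj G)"
proof -
  interpret pair_graph G using assms by (simp add: simple_graph_def)
  show "finite (pverts G)" "pverts G \<noteq> {}" "finite (parcs G)"
    "(x, y) \<in> parcs G \<Longrightarrow> (y, x) \<in> parcs G" "(x, y) \<in> parcs G \<Longrightarrow> x \<noteq> y"
    using assms no_loops' arcs_symmetric by (auto simp: simple_graph_def)
  show "parcs G \<subseteq> pverts G \<times> pverts G" using in_arcsD1 in_arcsD2 by auto
  show "wf_digraph (with_proj G)" by unfold_locales
qed

lemma simple_graphI:
  assumes "finite (pverts G)" "pverts G \<noteq> {}" "parcs G \<subseteq> pverts G \<times> pverts G"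
    "sym (parcs G)" "irrefl (parcs G)"
  shows "simple_graph G"
proof -
  have "finite (parcs G)" using assms(1,3) finite_subset by blast
  then have "pair_graph G"
    using assms by unfold_locales (auto simp: symmetric_def irrefl_def)
  then show ?thesis using assms by (simp add: simple_graph_def)
qed

lemma edges_between_disjoint:
  assumes "X \<inter> Y = {}"
  shows "edges_between G X Y = card (parcs G \<inter> X \<times> Y)"
proof -
  have "{{x, y} | x y. x \<in> X \<and> y \<in> Y \<and> (x, y) \<in> parcs G} = (\<lambda>(x, y). {x, y}) ` (parcs G \<inter> X \<times> Y)"
    by auto
  moreover have "inj_on (\<lambda>(x, y). {x, y}) (parcs G \<inter> X \<times> Y)"
    using assms by (auto simp: inj_on_def doubleton_eq_iff)
  ultimately show ?thesis unfolding edges_between_def by (simp add: card_image)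
qed

lemma edges_between_eq_0_iff:
  assumes "simple_graph G"
  shows "edges_between G X Y = 0 \<longleftrightarrow> parcs G \<inter> X \<times> Y = {}"
proof -
  have "{{x, y} | x y. x \<in> X \<and> y \<in> Y \<and> (x, y) \<in> parcs G} = (\<lambda>(x, y). {x, y}) ` (parcs G \<inter> X \<times> Y)"
    by auto
  then show ?thesis
    unfolding edges_between_def using simple_graphD(4)[OF assms] by simp
qed

text \<open>What a colouring with values in \<open>0, \<dots>, t\<close> says about single edges; the other half of the
  distance condition, about paths of length two, is \<open>scattered\<close>. Keeping the two apart matters
  because the partition of a stationary graph is a layering but need not be scattered.\<close>

definition layering :: "nat \<Rightarrow> 'a pair_pre_digraph \<Rightarrow> (nat \<Rightarrow> 'a set) \<Rightarrow> bool" where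
  "layering t G V \<longleftrightarrow> indexed_partition t (pverts G) V \<and>
     (\<forall>i\<le>t. \<forall>j\<le>t. \<forall>x\<in>V i. \<forall>y\<in>V j. (x, y) \<in> parcs G \<longrightarrow> i + 2 \<le> j \<or> j + 2 \<le> i)"

definition scattered :: "nat \<Rightarrow> 'a pair_pre_digraph \<Rightarrow> (nat \<Rightarrow> 'a set) \<Rightarrow> bool" where
  "scattered t G V \<longleftrightarrow>
     (\<forall>i\<le>t. \<forall>y\<in>V i. \<forall>z\<in>V i. \<forall>x. (x, y) \<in> parcs G \<and> (x, z) \<in> parcs G \<longrightarrow> y = z)"

definition saturated :: "nat \<Rightarrow> 'a pair_pre_digraph \<Rightarrow> (nat \<Rightarrow> 'a set) \<Rightarrow> bool" where
  "saturated t G V \<longleftrightarrow>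
     (\<forall>i\<le>t. \<forall>j\<le>t. 0 < card (V i) \<and> card (V i) \<le> card (V j) \<and> \<bar>int i - int j\<bar> \<ge> 2 \<longrightarrow>
        (\<forall>x\<in>V i. \<exists>!y. y \<in> V j \<and> (x, y) \<in> parcs G))"

lemma layering_iff:
  assumes "simple_graph G"
  shows "layering t G V \<longleftrightarrow> indexed_partition t (pverts G) V \<and>
     (\<forall>i\<le>t. edges_between G (V i) (V i) = 0) \<and> (\<forall>i<t. edges_between G (V i) (V (i + 1)) = 0)"
proof -
  have "(\<forall>i\<le>t. \<forall>j\<le>t. \<forall>x\<in>V i. \<forall>y\<in>V j. (x, y) \<in> parcs G \<longrightarrow> i + 2 \<le> j \<or> j + 2 \<le> i)"
    if same: "\<forall>i\<le>t. parcs G \<inter> V i \<times> V i = {}" and suc: "\<forall>i<t. parcs G \<inter> V i \<times> V (i + 1) = {}"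
  proof (intro allI ballI impI)
    fix i j x y assume *: "i \<le> t" "j \<le> t" "x \<in> V i" "y \<in> V j" "(x, y) \<in> parcs G"
    have "(y, x) \<in> parcs G" using simple_graphD(5)[OF assms] * by blast
    have "i \<noteq> j"
    proof
      assume "i = j"
      then have "(x, y) \<in> parcs G \<inter> V i \<times> V i" using * by auto
      then show False using same *(1) by blast
    qed
    moreover have "j \<noteq> i + 1"
    proof
      assume "j = i + 1"
      then have "i < t" "(x, y) \<in> parcs G \<inter> V i \<times> V (i + 1)" using * by auto
      then show False using suc by blast
    qed
    moreover have "i \<noteq> j + 1"
    proof
      assume "i = j + 1"
      then have "j < t" "(y, x) \<in> parcs G \<inter> V j \<times> V (j + 1)" using * \<open>(y, x) \<in> parcs G\<close> by auto
      then show False using suc by blast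
    qed
    ultimately show "i + 2 \<le> j \<or> j + 2 \<le> i" by linarith
  qed
  moreover have "parcs G \<inter> V i \<times> V i = {}" "i < t \<Longrightarrow> parcs G \<inter> V i \<times> V (i + 1) = {}"
    if far: "\<forall>i\<le>t. \<forall>j\<le>t. \<forall>x\<in>V i. \<forall>y\<in>V j. (x, y) \<in> parcs G \<longrightarrow> i + 2 \<le> j \<or> j + 2 \<le> i"
      and "i \<le> t" for i
  proof -
    have "i + 2 \<le> j \<or> j + 2 \<le> i" if "j \<le> t" "x \<in> V i" "y \<in> V j" "(x, y) \<in> parcs G" for j x y
      using far \<open>i \<le> t\<close> that by blast
    from this[of i] this[of "i + 1"] \<open>i \<le> t\<close> show "parcs G \<inter> V i \<times> V i = {}"
      "i < t \<Longrightarrow> parcs G \<inter> V i \<times> V (i + 1) = {}" by auto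
  qed
  ultimately have "(\<forall>i\<le>t. \<forall>j\<le>t. \<forall>x\<in>V i. \<forall>y\<in>V j. (x, y) \<in> parcs G \<longrightarrow> i + 2 \<le> j \<or> j + 2 \<le> i) \<longleftrightarrow>
      (\<forall>i\<le>t. parcs G \<inter> V i \<times> V i = {}) \<and> (\<forall>i<t. parcs G \<inter> V i \<times> V (i + 1) = {})"
    by (intro iffI conjI allI impI) simp_all
  then show ?thesis
    unfolding layering_def edges_between_eq_0_iff[OF assms] by simp
qed

lemma indexed_partitionD:
  assumes "indexed_partition t A V"
  shows "i \<le> t \<Longrightarrow> V i \<subseteq> A" "x \<in> A \<Longrightarrow> \<exists>i\<le>t. x \<in> V i"
    "i \<le> t \<Longrightarrow> j \<le> t \<Longrightarrow> x \<in> V i \<Longrightarrow> x \<in> V j \<Longrightarrow> i = j"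
  using assms unfolding indexed_partition_def disjoint_family_on_def by blast+

lemma sum_card_indexed_partition:
  assumes "indexed_partition t A V" "finite A"
  shows "(\<Sum>i\<le>t. card (V i)) = card A"
proof -
  have "card (\<Union>i\<le>t. V i) = (\<Sum>i\<le>t. card (V i))"
    using assms by (intro card_UN_disjoint)
      (auto simp: indexed_partition_def disjoint_family_on_def intro: finite_subset)
  then show ?thesis using assms by (simp add: indexed_partition_def)
qed

lemma edge_count_layering:
  assumes G: "simple_graph G" and V: "layering t G V"
  shows "edge_count G = (\<Sum>(i, j)\<in>spread_pairs t. edges_between G (V i) (V j))"
proof -
  define E where "E p = {{x, y} | x y. x \<in> V (fst p) \<and> y \<in> V (snd p) \<and> (x, y) \<in> parcs G}" for p
  have part: "indexed_partition t (pverts G) V" using V by (simp add: layering_def)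
  have fin: "finite (E p)" for p
    by (rule finite_subset[of _ "(\<lambda>(x, y). {x, y}) ` parcs G"])
      (use simple_graphD(4)[OF G] in \<open>auto simp: E_def\<close>)
  have disj: "E p \<inter> E p' = {}" if p: "p \<in> spread_pairs t" "p' \<in> spread_pairs t" "p \<noteq> p'" for p p'
  proof (rule ccontr)
    assume "E p \<inter> E p' \<noteq> {}"
    then obtain x y x' y' where *: "x \<in> V (fst p)" "y \<in> V (snd p)" "x' \<in> V (fst p')" "y' \<in> V (snd p')"
      "{x, y} = {x', y'}" unfolding E_def by blast
    have le: "fst p < snd p" "fst p' < snd p'" "fst p \<le> t" "snd p \<le> t" "fst p' \<le> t" "snd p' \<le> t"
      using p by (auto simp: spread_pairs_def)
    from *(5) consider "x = x'" "y = y'" | "x = y'" "y = x'" by (auto simp: doubleton_eq_iff)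
    then show False
    proof cases
      case 1
      then have "fst p = fst p'" "snd p = snd p'" using * le indexed_partitionD(3)[OF part] by metis+
      then show False using p(3) by (simp add: prod_eq_iff)
    next
      case 2
      then have "fst p = snd p'" "snd p = fst p'" using * le indexed_partitionD(3)[OF part] by metis+
      then show False using le by simp
    qed
  qed
  have "{{x, y} | x y. (x, y) \<in> parcs G} = (\<Union>p\<in>spread_pairs t. E p)"
  proof
    show "{{x, y} | x y. (x, y) \<in> parcs G} \<subseteq> (\<Union>p\<in>spread_pairs t. E p)"
    proof
      fix e assume "e \<in> {{x, y} | x y. (x, y) \<in> parcs G}"
      then obtain x y where e: "e = {x, y}" "(x, y) \<in> parcs G" by auto
      then have yx: "(y, x) \<in> parcs G" "e = {y, x}" using simple_graphD(5)[OF G] by auto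
      obtain i j where ij: "i \<le> t" "j \<le> t" "x \<in> V i" "y \<in> V j"
        using e simple_graphD(3)[OF G] indexed_partitionD(2)[OF part] by blast
      then have "i + 2 \<le> j \<or> j + 2 \<le> i" using V e unfolding layering_def by blast
      then have "(i, j) \<in> spread_pairs t \<and> e \<in> E (i, j) \<or> (j, i) \<in> spread_pairs t \<and> e \<in> E (j, i)"
        using ij e yx unfolding spread_pairs_def E_def by auto
      then show "e \<in> (\<Union>p\<in>spread_pairs t. E p)" by blast
    qed
  qed (auto simp: E_def)
  then have "edge_count G = card (\<Union>p\<in>spread_pairs t. E p)" by (simp add: edge_count_def)
  also have "\<dots> = (\<Sum>p\<in>spread_pairs t. card (E p))"
    using finite_spread_pairs fin disj by (intro card_UN_disjoint) auto
  finally show ?thesis by (simp add: E_def edges_between_def case_prod_beta)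
qed

lemma card_matched_arcs:
  assumes "finite X" "\<forall>x\<in>X. \<exists>!y. y \<in> Y \<and> (x, y) \<in> R"
  shows "card (R \<inter> X \<times> Y) = card X"
proof -
  have "inj_on fst (R \<inter> X \<times> Y)"
    using assms(2) by (intro inj_onI) (metis IntD1 IntD2 mem_Times_iff prod.collapse)
  moreover have "fst ` (R \<inter> X \<times> Y) = X"
  proof
    show "X \<subseteq> fst ` (R \<inter> X \<times> Y)"
    proof
      fix x assume "x \<in> X"
      then obtain y where "(x, y) \<in> R \<inter> X \<times> Y" using assms(2) by blast
      then show "x \<in> fst ` (R \<inter> X \<times> Y)" by (metis fst_conv image_eqI)
    qed
  qed auto
  ultimately show ?thesis by (metis card_image)
qed

text \<open>The projection to \<open>X\<close> is injective on the arcs between \<open>X\<close> and \<open>Y\<close>; equality of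
  cardinalities makes it surjective.\<close>

lemma card_matching_le:
  assumes "finite X" "\<And>x y z. (x, y) \<in> R \<Longrightarrow> (x, z) \<in> R \<Longrightarrow> y \<in> Y \<Longrightarrow> z \<in> Y \<Longrightarrow> y = z"
  shows "card (R \<inter> X \<times> Y) \<le> card X"
    and "card (R \<inter> X \<times> Y) = card X \<Longrightarrow> \<forall>x\<in>X. \<exists>!y. y \<in> Y \<and> (x, y) \<in> R"
proof -
  have inj: "inj_on fst (R \<inter> X \<times> Y)" using assms(2) by (auto simp: inj_on_def)
  have sub: "fst ` (R \<inter> X \<times> Y) \<subseteq> X" by auto
  show "card (R \<inter> X \<times> Y) \<le> card X"
    using card_inj_on_le[OF inj sub assms(1)] .
  assume "card (R \<inter> X \<times> Y) = card X"
  then have "fst ` (R \<inter> X \<times> Y) = X"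
    using card_subset_eq[OF assms(1) sub] card_image[OF inj] by simp
  then have "\<exists>y. y \<in> Y \<and> (x, y) \<in> R" if x: "x \<in> X" for x
  proof -
    obtain p where "p \<in> R \<inter> X \<times> Y" "fst p = x" using x \<open>fst ` (R \<inter> X \<times> Y) = X\<close> by (metis imageE)
    then show ?thesis by (cases p) auto
  qed
  then show "\<forall>x\<in>X. \<exists>!y. y \<in> Y \<and> (x, y) \<in> R" by (metis assms(2))
qed

lemma edges_between_commute:
  assumes "simple_graph G"
  shows "edges_between G X Y = edges_between G Y X"
proof -
  have "{{x, y} | x y. x \<in> X \<and> y \<in> Y \<and> (x, y) \<in> parcs G} =
      {{x, y} | x y. x \<in> Y \<and> y \<in> X \<and> (x, y) \<in> parcs G}"
    using simple_graphD(5)[OF assms] by (auto simp: insert_commute)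
  then show ?thesis by (simp add: edges_between_def)
qed

lemma layering_parts:
  assumes "simple_graph G" "layering t G V"
  shows "i \<le> t \<Longrightarrow> finite (V i)" "i \<le> t \<Longrightarrow> j \<le> t \<Longrightarrow> i \<noteq> j \<Longrightarrow> V i \<inter> V j = {}"
proof -
  have part: "indexed_partition t (pverts G) V" using assms by (simp add: layering_def)
  show "i \<le> t \<Longrightarrow> finite (V i)"
    using indexed_partitionD(1)[OF part] simple_graphD(1)[OF assms(1)] finite_subset by blast
  show "i \<le> t \<Longrightarrow> j \<le> t \<Longrightarrow> i \<noteq> j \<Longrightarrow> V i \<inter> V j = {}"
    using indexed_partitionD(3)[OF part] by blast
qed

text \<open>Counting from the smaller class suffices: it does not matter whether a vertex of the larger
  class has several neighbours in the smaller one.\<close>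

lemma saturated_edge_count:
  assumes G: "simple_graph G" and V: "layering t G V" and sat: "saturated t G V"
  shows "edge_count G = matching_total t (\<lambda>i. card (V i))"
proof -
  have le: "edges_between G (V i) (V j) = card (V i)"
    if "i \<le> t" "j \<le> t" "card (V i) \<le> card (V j)" "\<bar>int i - int j\<bar> \<ge> 2" for i j
  proof (cases "V i = {}")
    case True
    then show ?thesis by (simp add: edges_between_def)
  next
    case False
    then have "0 < card (V i)" using layering_parts(1)[OF G V that(1)] by (simp add: card_gt_0_iff)
    then have "\<forall>x\<in>V i. \<exists>!y. y \<in> V j \<and> (x, y) \<in> parcs G"
      using sat that unfolding saturated_def by blast
    moreover have "V i \<inter> V j = {}" using layering_parts(2)[OF G V that(1,2)] that(4) by fastforce
    ultimately show ?thesis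
      using card_matched_arcs layering_parts(1)[OF G V that(1)] by (simp add: edges_between_disjoint)
  qed
  have "edges_between G (V i) (V j) = min (card (V i)) (card (V j))" if "(i, j) \<in> spread_pairs t" for i j
    using le[of i j] le[of j i] edges_between_commute[OF G, of "V i" "V j"] that
    by (auto simp: spread_pairs_def min_def)
  then show ?thesis
    unfolding edge_count_layering[OF G V] matching_total_def by (intro sum.cong) auto
qed

text \<open>Each pair of classes contributes at most the size of the smaller one, so equality of the
  totals forces equality for each pair.\<close>

lemma scattered_edge_count:
  assumes G: "simple_graph G" and V: "layering t G V" and sc: "scattered t G V"
  shows "edge_count G \<le> matching_total t (\<lambda>i. card (V i))"
    and "edge_count G = matching_total t (\<lambda>i. card (V i)) \<Longrightarrow> saturated t G V"
proof -
  have one: "edges_between G (V i) (V j) \<le> card (V i)"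
    "edges_between G (V i) (V j) = card (V i) \<Longrightarrow> \<forall>x\<in>V i. \<exists>!y. y \<in> V j \<and> (x, y) \<in> parcs G"
    if "i \<le> t" "j \<le> t" "i \<noteq> j" for i j
    using card_matching_le[OF layering_parts(1)[OF G V that(1)], of "parcs G" "V j"] sc that(2)
    unfolding scattered_def edges_between_disjoint[OF layering_parts(2)[OF G V that]] by blast+
  have le: "edges_between G (V i) (V j) \<le> min (card (V i)) (card (V j))" if "(i, j) \<in> spread_pairs t" for i j
    using one(1)[of i j] one(1)[of j i] edges_between_commute[OF G, of "V i" "V j"] that
    by (auto simp: spread_pairs_def)
  then show "edge_count G \<le> matching_total t (\<lambda>i. card (V i))"
    unfolding edge_count_layering[OF G V] matching_total_def by (intro sum_mono) auto
  assume "edge_count G = matching_total t (\<lambda>i. card (V i))"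
  then have "(\<Sum>p\<in>spread_pairs t. edges_between G (V (fst p)) (V (snd p))) =
      (\<Sum>p\<in>spread_pairs t. min (card (V (fst p))) (card (V (snd p))))"
    unfolding edge_count_layering[OF G V] matching_total_def by (simp add: case_prod_beta)
  then have eq: "edges_between G (V i) (V j) = min (card (V i)) (card (V j))"
    if "(i, j) \<in> spread_pairs t" for i j
    using sum_mono_inv[of "\<lambda>p. edges_between G (V (fst p)) (V (snd p))" "spread_pairs t"
        "\<lambda>p. min (card (V (fst p))) (card (V (snd p)))" "(i, j)"] le that finite_spread_pairs[of t]
    by simp
  show "saturated t G V"
    unfolding saturated_def
  proof (intro allI impI)
    fix i j assume *: "i \<le> t" "j \<le> t" "0 < card (V i) \<and> card (V i) \<le> card (V j) \<and> 2 \<le> \<bar>int i - int j\<bar>"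
    then have "(i, j) \<in> spread_pairs t \<or> (j, i) \<in> spread_pairs t" by (auto simp: spread_pairs_def)
    then have "edges_between G (V i) (V j) = card (V i)"
      using eq[of i j] eq[of j i] edges_between_commute[OF G, of "V i" "V j"] * by (auto simp: min_def)
    moreover have "i \<noteq> j" using * by auto
    ultimately show "\<forall>x\<in>V i. \<exists>!y. y \<in> V j \<and> (x, y) \<in> parcs G" using one(2)[OF *(1,2)] by blast
  qed
qed

section \<open>Lambda colourings and partitions\<close>

lemma graph_dist_le_walk:
  assumes "simple_graph G"
  shows "(u, v) \<in> parcs G \<Longrightarrow> graph_dist G u v \<le> 1"
    and "(u, w) \<in> parcs G \<Longrightarrow> (w, v) \<in> parcs G \<Longrightarrow> graph_dist G u v \<le> 2"
proof -
  interpret wf_digraph "with_proj G" by (rule simple_graphD(7)[OF assms])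
  note verts = subsetD[OF simple_graphD(3)[OF assms]]
  show "graph_dist G u v \<le> 1" if "(u, v) \<in> parcs G"
  proof -
    have "awalk u [(u, v)] v" using that verts[OF that] by (simp add: awalk_def cas.simps)
    from min_cost_le_walk_cost[OF this, of "\<lambda>_. 1"] show ?thesis
      by (simp add: graph_dist_def one_ereal_def)
  qed
  show "graph_dist G u v \<le> 2" if "(u, w) \<in> parcs G" "(w, v) \<in> parcs G"
  proof -
    have "awalk u [(u, w), (w, v)] v"
      using that verts[OF that(1)] by (simp add: awalk_def cas.simps)
    from min_cost_le_walk_cost[OF this, of "\<lambda>_. 1"] show ?thesis
      by (simp add: graph_dist_def)
  qed
qed

lemma graph_dist_ge:
  assumes "simple_graph G" "u \<noteq> v"
  shows "1 \<le> graph_dist G u v"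
    and "(u, v) \<notin> parcs G \<Longrightarrow> 2 \<le> graph_dist G u v"
    and "(u, v) \<notin> parcs G \<Longrightarrow> (\<And>w. (u, w) \<in> parcs G \<Longrightarrow> (w, v) \<notin> parcs G) \<Longrightarrow> 3 \<le> graph_dist G u v"
proof -
  interpret wf_digraph "with_proj G" by (rule simple_graphD(7)[OF assms(1)])
  have ge: "ereal (real k) \<le> graph_dist G u v" if "\<And>p. awalk u p v \<Longrightarrow> k \<le> length p" for k
  proof -
    have "ereal (real k) \<le> ereal (awalk_cost (\<lambda>_. 1) p)" if "awalk u p v" for p
      using \<open>\<And>p. awalk u p v \<Longrightarrow> k \<le> length p\<close>[OF that]
      by (simp add: awalk_cost_def sum_list_triv)
    then show ?thesis unfolding graph_dist_def \<mu>_def by (auto intro: INF_greatest)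
  qed
  have len1: "1 \<le> length p" if "awalk u p v" for p
    using that assms(2) by (cases p) (auto simp: awalk_def cas.simps)
  then show "1 \<le> graph_dist G u v" using ge[of 1] by (simp add: one_ereal_def)
  have len2: "2 \<le> length p" if "awalk u p v" "(u, v) \<notin> parcs G" for p
  proof (cases p)
    case Nil
    then show ?thesis using len1[OF that(1)] by simp
  next
    case (Cons e p')
    then show ?thesis using that by (cases p') (auto simp: awalk_def cas.simps)
  qed
  then show "(u, v) \<notin> parcs G \<Longrightarrow> 2 \<le> graph_dist G u v" using ge[of 2] by simp
  have len3: "3 \<le> length p"
    if p: "awalk u p v" "(u, v) \<notin> parcs G" "\<And>w. (u, w) \<in> parcs G \<Longrightarrow> (w, v) \<notin> parcs G" for p
  proof (rule ccontr)
    assume "\<not> 3 \<le> length p"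
    then have "length p = 2" using len2[OF p(1,2)] by simp
    then obtain e f where "p = [e, f]" by (auto simp: numeral_2_eq_2 length_Suc_conv)
    then show False using p by (cases e; cases f) (auto simp: awalk_def cas.simps)
  qed
  then show "(u, v) \<notin> parcs G \<Longrightarrow> (\<And>w. (u, w) \<in> parcs G \<Longrightarrow> (w, v) \<notin> parcs G) \<Longrightarrow> 3 \<le> graph_dist G u v"
    using ge[of 3] by simp
qed

text \<open>An edge has length 1 and a path through a common neighbour has length at most 2, so the
  colours of their ends differ by at least 2 and 1, respectively.\<close>

lemma colouring_layering:
  assumes G: "simple_graph G" and c: "lambda_colouring G c" and m: "Max (c ` pverts G) \<le> t"
  defines "V \<equiv> \<lambda>i. {v \<in> pverts G. c v = i}"
  shows "layering t G V" "scattered t G V"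
proof -
  have sep: "3 \<le> ereal \<bar>real (c u) - real (c v)\<bar> + graph_dist G u v"
    if "u \<in> pverts G" "v \<in> pverts G" "u \<noteq> v" for u v
    using c that by (simp add: lambda_colouring_def)
  have le: "c v \<le> t" if "v \<in> pverts G" for v
    using m that simple_graphD(1)[OF G] by (meson Max_ge finite_imageI image_eqI le_trans)
  have part: "indexed_partition t (pverts G) V"
    using le by (auto simp: indexed_partition_def disjoint_family_on_def V_def)
  have "i + 2 \<le> j \<or> j + 2 \<le> i" if "x \<in> V i" "y \<in> V j" "(x, y) \<in> parcs G" for i j x y
  proof -
    have "ereal 3 \<le> ereal \<bar>real (c x) - real (c y)\<bar> + graph_dist G x y"
      using sep[of x y] that simple_graphD(6)[OF G that(3)] by (auto simp: V_def)
    also have "\<dots> \<le> ereal \<bar>real (c x) - real (c y)\<bar> + ereal 1"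
      using graph_dist_le_walk(1)[OF G that(3)] by (intro add_left_mono) (simp add: one_ereal_def)
    finally have "2 \<le> \<bar>real i - real j\<bar>" using that by (simp add: V_def)
    then show ?thesis by linarith
  qed
  then show "layering t G V" using part unfolding layering_def by blast
  have "y = z" if "y \<in> V i" "z \<in> V i" "(x, y) \<in> parcs G" "(x, z) \<in> parcs G" for i x y z
  proof (rule ccontr)
    assume "y \<noteq> z"
    then have "3 \<le> ereal \<bar>real (c y) - real (c z)\<bar> + graph_dist G y z"
      using sep[of y z] that by (auto simp: V_def)
    also have "\<dots> = graph_dist G y z" using that by (simp add: V_def flip: zero_ereal_def)
    also have "\<dots> \<le> 2"
      using graph_dist_le_walk(2)[OF G simple_graphD(5)[OF G that(3)] that(4)] .
    finally show False by simp
  qed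
  then show "scattered t G V" unfolding scattered_def by blast
qed

text \<open>Colouring each vertex by the index of its class works: distinct vertices are at distance at
  least 1, at least 2 if they are not adjacent, and at least 3 if they have no common neighbour
  either. The end classes provide the colours \<open>0\<close> and \<open>t\<close>.\<close>

lemma layering_colouring:
  assumes G: "simple_graph G" and V: "layering t G V" and sc: "scattered t G V"
    and ends: "V 0 \<noteq> {}" "V t \<noteq> {}"
  shows "\<exists>c. lambda_colouring G c \<and> Max (c ` pverts G) = t"
proof -
  have part: "indexed_partition t (pverts G) V" using V by (simp add: layering_def)
  define c where "c v = (THE i. i \<le> t \<and> v \<in> V i)" for v
  have c_eq: "c v = i" if "i \<le> t" "v \<in> V i" for v i
    unfolding c_def using that indexed_partitionD(3)[OF part] by blast
  have c: "c v \<le> t \<and> v \<in> V (c v)" if "v \<in> pverts G" for v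
    using indexed_partitionD(2)[OF part that] c_eq by metis
  have sep: "3 \<le> ereal \<bar>real (c u) - real (c v)\<bar> + graph_dist G u v"
    if uv: "u \<in> pverts G" "v \<in> pverts G" "u \<noteq> v" for u v
  proof -
    have bound: "3 \<le> ereal \<bar>real (c u) - real (c v)\<bar> + graph_dist G u v"
      if "ereal d \<le> graph_dist G u v" "3 - d \<le> \<bar>real (c u) - real (c v)\<bar>" for d
    proof -
      have "3 \<le> ereal \<bar>real (c u) - real (c v)\<bar> + ereal d" using that(2) by simp
      also have "\<dots> \<le> ereal \<bar>real (c u) - real (c v)\<bar> + graph_dist G u v"
        using that(1) by (rule add_left_mono)
      finally show ?thesis .
    qed
    have far: "c u + 2 \<le> c v \<or> c v + 2 \<le> c u" if "(u, v) \<in> parcs G"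
      using V that c[OF uv(1)] c[OF uv(2)] unfolding layering_def by blast
    consider "c u + 2 \<le> c v \<or> c v + 2 \<le> c u" | "(u, v) \<notin> parcs G" "c u \<noteq> c v"
      | "(u, v) \<notin> parcs G" "c u = c v" using far by blast
    then show ?thesis
    proof cases
      case 1
      then have "2 \<le> \<bar>real (c u) - real (c v)\<bar>" by linarith
      then show ?thesis using bound[of 1] graph_dist_ge(1)[OF G uv(3)] by (simp add: one_ereal_def)
    next
      case 2
      then have "1 \<le> \<bar>real (c u) - real (c v)\<bar>" by linarith
      then show ?thesis using bound[of 2] graph_dist_ge(2)[OF G uv(3) 2(1)] by simp
    next
      case 3
      have "(w, v) \<notin> parcs G" if "(u, w) \<in> parcs G" for w
        using sc c[OF uv(1)] c[OF uv(2)] 3(2) uv(3) simple_graphD(5)[OF G that] simple_graphD(5)[OF G]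
        unfolding scattered_def by metis
      then show ?thesis using bound[of 3] graph_dist_ge(3)[OF G uv(3) 3(1)] by simp
    qed
  qed
  have fin: "finite (c ` pverts G)" using simple_graphD(1)[OF G] by simp
  obtain u w where u: "u \<in> V 0" "w \<in> V t" using ends by blast
  have uw: "u \<in> pverts G" "w \<in> pverts G" "c u = 0" "c w = t"
    using u c_eq indexed_partitionD(1)[OF part] by auto
  have "Min (c ` pverts G) = 0" using uw fin by (metis Min_le image_eqI le_zero_eq)
  moreover have "Max (c ` pverts G) = t" using uw fin c by (intro Max_eqI) force+
  ultimately show ?thesis using sep unfolding lambda_colouring_def by blast
qed

text \<open>The least number in the definition is taken over a non-empty set, since distinct even colours
  always work.\<close>

lemma lambda_number_attained:
  assumes G: "simple_graph G"
  shows "\<exists>c. lambda_colouring G c \<and> Max (c ` pverts G) = lambda_number G"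
proof -
  obtain h where h: "bij_betw h (pverts G) {0..<card (pverts G)}"
    using ex_bij_betw_finite_nat simple_graphD(1)[OF G] by blast
  have "0 < card (pverts G)" using simple_graphD(1,2)[OF G] by (simp add: card_gt_0_iff)
  define c where "c v = 2 * h v" for v
  have "3 \<le> ereal \<bar>real (c u) - real (c v)\<bar> + graph_dist G u v"
    if uv: "u \<in> pverts G" "v \<in> pverts G" "u \<noteq> v" for u v
  proof -
    have "h u \<noteq> h v" using h uv by (metis bij_betw_imp_inj_on inj_onD)
    then have "2 \<le> \<bar>real (c u) - real (c v)\<bar>" unfolding c_def by linarith
    then have "3 \<le> ereal \<bar>real (c u) - real (c v)\<bar> + ereal 1" by simp
    also have "\<dots> \<le> ereal \<bar>real (c u) - real (c v)\<bar> + graph_dist G u v"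
      using graph_dist_ge(1)[OF G uv(3)] by (intro add_left_mono) (simp add: one_ereal_def)
    finally show ?thesis .
  qed
  moreover have "Min (c ` pverts G) = 0"
  proof -
    have "0 \<in> h ` pverts G" using h \<open>0 < card (pverts G)\<close> by (simp add: bij_betw_def)
    then have "0 \<in> c ` pverts G" by (auto simp: c_def image_iff)
    then show ?thesis using simple_graphD(1)[OF G] by (metis Min_le finite_imageI le_zero_eq)
  qed
  ultimately have "lambda_colouring G c" by (simp add: lambda_colouring_def)
  then show ?thesis
    unfolding lambda_number_def by (intro LeastI[of "\<lambda>k. \<exists>c. lambda_colouring G c \<and> Max (c ` pverts G) = k"]) blast
qed

lemma edge_count_le_edge_bound:
  assumes G: "simple_graph G" and t: "3 \<le> t" and V: "layering t G V" "scattered t G V"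
  shows "int (edge_count G) \<le> edge_bound t (card (pverts G))"
    and "int (edge_count G) = edge_bound t (card (pverts G)) \<Longrightarrow>
      saturated t G V \<and> int (matching_total t (\<lambda>i. card (V i))) = edge_bound t (\<Sum>i\<le>t. card (V i))"
proof -
  have sum: "(\<Sum>i\<le>t. card (V i)) = card (pverts G)"
    using V(1) simple_graphD(1)[OF G] by (intro sum_card_indexed_partition) (auto simp: layering_def)
  note le = scattered_edge_count(1)[OF G V] matching_total_le_edge_bound(1)[OF t, of "\<lambda>i. card (V i)"]
  then show "int (edge_count G) \<le> edge_bound t (card (pverts G))" unfolding sum by linarith
  assume "int (edge_count G) = edge_bound t (card (pverts G))"
  then have "edge_count G = matching_total t (\<lambda>i. card (V i))"
    "int (matching_total t (\<lambda>i. card (V i))) = edge_bound t (\<Sum>i\<le>t. card (V i))"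
    using le unfolding sum by linarith+
  then show "saturated t G V \<and>
      int (matching_total t (\<lambda>i. card (V i))) = edge_bound t (\<Sum>i\<le>t. card (V i))"
    using scattered_edge_count(2)[OF G V] by blast
qed

text \<open>If the largest colour were below \<open>t\<close>, the colour classes together with empty ones up to \<open>t\<close> would
  again form a scattered layering with the maximum number of edges, but tight size vectors are
  positive at \<open>t\<close>.\<close>

lemma lambda_number_eqI:
  assumes G: "simple_graph G" and t: "3 \<le> t" "t + 1 \<le> card (pverts G)"
    and V: "layering t G V" "scattered t G V"
    and max: "int (edge_count G) = edge_bound t (card (pverts G))"
  shows "lambda_number G = t"
proof -
  have ends: "W 0 \<noteq> {}" "W t \<noteq> {}" if W: "layering t G W" "scattered t G W" for W
  proof -
    have "(\<Sum>i\<le>t. card (W i)) = card (pverts G)"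
      using W(1) simple_graphD(1)[OF G] by (intro sum_card_indexed_partition) (auto simp: layering_def)
    then have "0 < card (W 0)" "0 < card (W t)"
      using tight_ends(1,2)[OF t(1)] edge_count_le_edge_bound(2)[OF G t(1) W max] t(2) by metis+
    then show "W 0 \<noteq> {}" "W t \<noteq> {}" by auto
  qed
  obtain c where c: "lambda_colouring G c" "Max (c ` pverts G) = lambda_number G"
    using lambda_number_attained[OF G] by blast
  have "lambda_number G \<le> t"
    unfolding lambda_number_def using layering_colouring[OF G V ends[OF V]] by (rule Least_le)
  moreover have "{v \<in> pverts G. c v = t} \<noteq> {}"
    using ends(2)[OF colouring_layering[OF G c(1)]] c(2) calculation by simp
  then obtain v where "v \<in> pverts G" "c v = t" by blast
  then have "t \<le> lambda_number G"
    using c(2) simple_graphD(1)[OF G] by (metis Max_ge finite_imageI imageI)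
  ultimately show ?thesis by simp
qed

text \<open>The graph with prescribed class sizes whose matchings join vertices at the same height. Pairs
  of a class index and a height are coded as natural numbers to stay within the vertex type of the
  competitors.\<close>

definition level_graph :: "nat \<Rightarrow> (nat \<Rightarrow> nat) \<Rightarrow> nat pair_pre_digraph" where
  "level_graph t a = \<lparr>
     pverts = prod_encode ` {(i, k). i \<le> t \<and> k < a i},
     parcs = {(prod_encode (i, k), prod_encode (j, k)) | i j k.
       i \<le> t \<and> j \<le> t \<and> k < a i \<and> k < a j \<and> (i + 2 \<le> j \<or> j + 2 \<le> i)}\<rparr>"

definition level_class :: "(nat \<Rightarrow> nat) \<Rightarrow> nat \<Rightarrow> nat set" where
  "level_class a i = (\<lambda>k. prod_encode (i, k)) ` {..<a i}"

lemma card_level_class [simp]: "card (level_class a i) = a i"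
  unfolding level_class_def by (simp add: card_image inj_on_def)

lemma level_graph_partition: "indexed_partition t (pverts (level_graph t a)) (level_class a)"
  unfolding indexed_partition_def disjoint_family_on_def level_class_def level_graph_def by auto

lemma level_graph_simple:
  assumes "0 < (\<Sum>i\<le>t. a i)"
  shows "simple_graph (level_graph t a)"
proof (rule simple_graphI)
  have "{(i, k). i \<le> t \<and> k < a i} = (SIGMA i:{..t}. {..<a i})" by auto
  then show "finite (pverts (level_graph t a))" by (simp add: level_graph_def)
  obtain i where "i \<le> t" "0 < a i" using assms by (metis (no_types, lifting) atMost_iff gr0I less_irrefl sum.neutral)
  then show "pverts (level_graph t a) \<noteq> {}" by (auto simp: level_graph_def)
qed (auto simp: level_graph_def sym_def irrefl_def)

lemma card_level_graph: "card (pverts (level_graph t a)) = (\<Sum>i\<le>t. a i)"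
proof -
  have "{(i, k). i \<le> t \<and> k < a i} = (SIGMA i:{..t}. {..<a i})" by auto
  then have "finite (pverts (level_graph t a))" by (simp add: level_graph_def)
  from sum_card_indexed_partition[OF level_graph_partition this] show ?thesis by simp
qed

lemma level_graph_layering: "layering t (level_graph t a) (level_class a)"
  unfolding layering_def using level_graph_partition[of t a] by (auto simp: level_class_def level_graph_def)

lemma level_graph_scattered: "scattered t (level_graph t a) (level_class a)"
  unfolding scattered_def by (auto simp: level_class_def level_graph_def)

lemma level_graph_saturated: "saturated t (level_graph t a) (level_class a)"
  unfolding saturated_def
proof (intro allI impI ballI)
  fix i j x
  assume ij: "i \<le> t" "j \<le> t"
    "0 < card (level_class a i) \<and> card (level_class a i) \<le> card (level_class a j) \<and> 2 \<le> \<bar>int i - int j\<bar>"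
    and "x \<in> level_class a i"
  then obtain k where x: "x = prod_encode (i, k)" "k < a i" by (auto simp: level_class_def)
  have "i + 2 \<le> j \<or> j + 2 \<le> i" "k < a j" using ij x by (linarith, simp)
  then show "\<exists>!y. y \<in> level_class a j \<and> (x, y) \<in> parcs (level_graph t a)"
    using ij x by (intro ex1I[of _ "prod_encode (j, k)"]) (auto simp: level_class_def level_graph_def)
qed

section \<open>Size patterns of partitions\<close>

lemma equitable_two_level:
  assumes "equitable t V"
  shows "\<exists>q. \<forall>i\<le>t. card (V i) = q \<or> card (V i) = q + 1"
proof -
  define q where "q = Min ((\<lambda>i. card (V i)) ` {..t})"
  have "q \<in> (\<lambda>i. card (V i)) ` {..t}" unfolding q_def by (rule Min_in) auto
  then obtain j where j: "j \<le> t" "card (V j) = q" by auto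
  have "card (V i) = q \<or> card (V i) = q + 1" if "i \<le> t" for i
  proof -
    have "q \<le> card (V i)" unfolding q_def using that by (intro Min_le) auto
    moreover have "\<bar>int (card (V i)) - int (card (V j))\<bar> \<le> 1"
      using assms that j unfolding equitable_def by blast
    ultimately show ?thesis using j by linarith
  qed
  then show ?thesis by blast
qed

lemma two_level_equitable:
  assumes "\<And>i. i \<le> t \<Longrightarrow> card (V i) = q + of_bool (i \<in> S)"
  shows "equitable t V"
  unfolding equitable_def using assms by simp

text \<open>If \<open>S\<close> is non-empty, the largest classes are those indexed by \<open>S\<close>, so \<open>K_value\<close> counts the
  consecutive pairs of \<open>S\<close>, the quantity that decides tightness.\<close>

lemma K_value_two_level:
  assumes V: "\<And>i. i \<le> t \<Longrightarrow> card (V i) = q + of_bool (i \<in> S)" and S: "S \<subseteq> {..t}" "S \<noteq> {}"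
  shows "K_value t V = card {i \<in> S. Suc i \<in> S}"
proof -
  obtain s where "s \<in> S" using S by blast
  then have s: "s \<le> t" "card (V s) = q + 1" using S V by auto
  have "Max ((\<lambda>j. card (V j)) ` {..t}) = q + 1"
  proof (rule Max_eqI)
    show "q + 1 \<in> (\<lambda>j. card (V j)) ` {..t}" using s by (metis atMost_iff image_eqI)
    show "y \<le> q + 1" if "y \<in> (\<lambda>j. card (V j)) ` {..t}" for y using that V by auto
  qed simp
  moreover have "i < t \<and> card (V i) = card (V (i + 1)) \<and> card (V (i + 1)) = q + 1 \<longleftrightarrow>
      i \<in> S \<and> Suc i \<in> S" for i
  proof (cases "i < t")
    case True
    then show ?thesis using V[of i] V[of "i + 1"] by (cases "i \<in> S"; cases "Suc i \<in> S") simp_all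
  next
    case False
    then show ?thesis using S(1) by auto
  qed
  ultimately have "{i. i < t \<and> card (V i) = card (V (i + 1)) \<and>
      card (V (i + 1)) = Max ((\<lambda>j. card (V j)) ` {..t})} = {i \<in> S. Suc i \<in> S}"
    by (simp only:)
  then show ?thesis by (simp add: K_value_def)
qed

text \<open>The patterns are mutually exclusive, so the uniqueness in \<open>satisfies_exactly_one_of\<close> comes
  for free.\<close>

lemma satisfies_unique:
  assumes "satisfies t V p" "satisfies t V p'"
  shows "p = p'"
proof -
  have eq: "card (V i) \<le> card (V j) + 1" if "equitable t V" "i \<le> t" "j \<le> t" for i j
    using that unfolding equitable_def by fastforce
  have not_equitable: "\<not> equitable t V" if "satisfies t V p" "p \<noteq> Pa" for p
  proof
    assume "equitable t V"
    note le = eq[OF this]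
    have "3 \<le> t" using that by (cases p) simp_all
    then show False
      using that(1) le[of 0 1] le[of 0 2] le[of 1 2] le[of 3 2]
      by (cases p) (simp_all add: that(2))
  qed
  show ?thesis
  proof (cases "p = Pa \<or> p' = Pa")
    case True
    then show ?thesis using assms not_equitable satisfies.simps(1) by metis
  next
    case False
    show ?thesis using assms False
      by (cases p; cases p'; hypsubst_thin; unfold satisfies.simps; (rule refl | linarith | blast))
  qed
qed

lemma satisfies_exactly_one_of_iff:
  "satisfies_exactly_one_of t V P \<longleftrightarrow> (\<exists>W\<in>{V, dual_partition t V}. \<exists>p\<in>P. satisfies t W p)"
  unfolding satisfies_exactly_one_of_def by (metis satisfies_unique)

lemma lopsided_iff_satisfies:
  "lopsided t (\<lambda>i. card (V i)) \<longleftrightarrow> satisfies_exactly_one_of t V {Pb, Pc, Pd, Pe, Pf, Pg}"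
proof -
  have expand: "(\<exists>W\<in>{A, B}. \<exists>p\<in>{Pb, Pc, Pd, Pe, Pf, Pg}. satisfies t W p) \<longleftrightarrow>
      (satisfies t A Pb \<or> satisfies t A Pc \<or> satisfies t A Pd \<or> satisfies t A Pe \<or>
       satisfies t A Pf \<or> satisfies t A Pg) \<or>
      (satisfies t B Pb \<or> satisfies t B Pc \<or> satisfies t B Pd \<or> satisfies t B Pe \<or>
       satisfies t B Pf \<or> satisfies t B Pg)" for A B :: "nat \<Rightarrow> 'a set" by blast
  note unfolds = satisfies_exactly_one_of_iff expand lopsided_def lopsided3_def lopsided4_def satisfies.simps
  consider "t = 3" "t \<noteq> 4" | "t = 4" "t \<noteq> 3" | "t \<noteq> 3" "t \<noteq> 4" by linarith
  then show ?thesis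
  proof cases
    case 1
    then have "dual_partition t V 0 = V 3" "dual_partition t V 1 = V 2" "dual_partition t V 2 = V 1"
      "dual_partition t V 3 = V 0" by (simp_all add: dual_partition_def)
    then show ?thesis using 1 unfolding unfolds by (simp only:) satx
  next
    case 2
    then have "dual_partition t V 0 = V 4" "dual_partition t V 1 = V 3" "dual_partition t V 2 = V 2"
      "dual_partition t V 3 = V 1" "dual_partition t V 4 = V 0" by (simp_all add: dual_partition_def)
    then show ?thesis using 2 unfolding unfolds by (simp only:) satx
  next
    case 3
    then show ?thesis unfolding unfolds by satx
  qed
qed

lemma lopsided_not_equitable:
  assumes "lopsided t (\<lambda>i. card (V i))"
  shows "\<not> equitable t V"
proof
  assume "equitable t V"
  moreover from this have "equitable t (dual_partition t V)"
    by (simp add: equitable_def dual_partition_def)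
  ultimately have "satisfies t W Pa" if "W \<in> {V, dual_partition t V}" for W using that by auto
  moreover obtain W p where "W \<in> {V, dual_partition t V}" "p \<in> {Pb, Pc, Pd, Pe, Pf, Pg}" "satisfies t W p"
    using assms unfolding lopsided_iff_satisfies satisfies_exactly_one_of_iff by blast
  ultimately show False using satisfies_unique[of t W p Pa] by blast
qed

section \<open>Extremal graphs\<close>

text \<open>This graph has two uses: it shows that the bound is attained by a graph with lambda
  chromatic number \<open>t\<close>, and its partition witnesses that \<open>crowding t (n mod (t + 1))\<close> is an attained
  value of \<open>K_value\<close>.\<close>

lemma extremal_level_graph:
  assumes t: "3 \<le> t" and n: "t + 1 \<le> n"
  obtains H :: "nat pair_pre_digraph" and U S where
    "simple_graph H" "card (pverts H) = n" "lambda_number H = t"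
    "int (edge_count H) = edge_bound t n" "indexed_partition t (pverts H) U"
    "S \<subseteq> {..t}" "card S = n mod (t + 1)" "int (card {i \<in> S. Suc i \<in> S}) = crowding t (n mod (t + 1))"
    "\<forall>i\<le>t. card (U i) = n div (t + 1) + of_bool (i \<in> S)"
proof -
  have r: "n mod (t + 1) \<le> t" by (simp flip: less_Suc_eq_le)
  obtain S where S: "S \<subseteq> {..t}" "card S = n mod (t + 1)"
    "int (card {i \<in> S. Suc i \<in> S}) = crowding t (n mod (t + 1))"
    using crowding_attained[OF r] by blast
  define a where "a i = n div (t + 1) + of_bool (i \<in> S)" for i
  have cS: "card S \<le> t" using r S(2) by simp
  have sum: "(\<Sum>i\<le>t. a i) = n"
    using two_level_tight_iff(1)[OF S(1) cS, of a "n div (t + 1)"] S(2) unfolding a_def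
    by (metis div_mult_mod_eq)
  have tight: "int (matching_total t a) = edge_bound t n"
    using two_level_tight_iff(2)[OF S(1) cS, of a "n div (t + 1)"] S(2,3) sum unfolding a_def by simp
  have simple: "simple_graph (level_graph t a)"
    using sum n by (intro level_graph_simple) simp
  have card: "card (pverts (level_graph t a)) = n" using sum by (simp add: card_level_graph)
  have count: "int (edge_count (level_graph t a)) = edge_bound t n"
    using saturated_edge_count[OF simple level_graph_layering level_graph_saturated] tight by simp
  have "lambda_number (level_graph t a) = t"
    using lambda_number_eqI[OF simple t _ level_graph_layering level_graph_scattered] card count n by simp
  then show ?thesis
    using that[of "level_graph t a" "level_class a" S] simple card count level_graph_partition S
    by (simp add: a_def)
qed

lemma lambda_number_partition:
  assumes G: "simple_graph G"
  obtains V where "layering (lambda_number G) G V" "scattered (lambda_number G) G V"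
proof -
  obtain c where c: "lambda_colouring G c" "Max (c ` pverts G) = lambda_number G"
    using lambda_number_attained[OF G] by blast
  show ?thesis by (rule that) (rule colouring_layering[OF G c(1)], simp add: c(2))+
qed

lemma has_max_edges_iff:
  fixes G :: "'a pair_pre_digraph"
  assumes G: "simple_graph G" and t: "lambda_number G = t" "3 \<le> t" and n: "t + 1 \<le> card (pverts G)"
  shows "has_max_edges G \<longleftrightarrow> int (edge_count G) = edge_bound t (card (pverts G))"
proof -
  have le: "int (edge_count H) \<le> edge_bound t (card (pverts H))"
    if H: "simple_graph H" "lambda_number H = t" for H :: "'b pair_pre_digraph"
    using lambda_number_partition[OF H(1)] edge_count_le_edge_bound(1)[OF H(1) t(2)] H(2) by metis
  show ?thesis
  proof
    assume "has_max_edges G"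
    moreover obtain H :: "nat pair_pre_digraph" where "simple_graph H" "card (pverts H) = card (pverts G)"
      "lambda_number H = t" "int (edge_count H) = edge_bound t (card (pverts G))"
      using extremal_level_graph[OF t(2) n] by metis
    ultimately have "edge_bound t (card (pverts G)) \<le> int (edge_count G)"
      using t(1) unfolding has_max_edges_def by force
    moreover have "int (edge_count G) \<le> edge_bound t (card (pverts G))"
      using lambda_number_partition[OF G] edge_count_le_edge_bound(1)[OF G t(2)] t(1) by metis
    ultimately show "int (edge_count G) = edge_bound t (card (pverts G))" by simp
  next
    assume eq: "int (edge_count G) = edge_bound t (card (pverts G))"
    have "edge_count H \<le> edge_count G"
      if H: "simple_graph H" "card (pverts H) = card (pverts G)" "lambda_number H = t"
      for H :: "nat pair_pre_digraph"
    proof -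
      have "int (edge_count H) \<le> edge_bound t (card (pverts H))"
        using lambda_number_partition[OF H(1)] edge_count_le_edge_bound(1)[OF H(1) t(2)] H(3) by metis
      then show ?thesis using eq H(2) by simp
    qed
    then show "has_max_edges G" unfolding has_max_edges_def t(1) by blast
  qed
qed

section \<open>Isomorphic copies\<close>

definition map_graph :: "('a \<Rightarrow> 'b) \<Rightarrow> 'a pair_pre_digraph \<Rightarrow> 'b pair_pre_digraph" where
  "map_graph f G = \<lparr>pverts = f ` pverts G, parcs = map_prod f f ` parcs G\<rparr>"

text \<open>The arc map of an isomorphism is determined by the vertex map, because tail and head of an arc
  are its two components.\<close>

lemma graph_isomorphic_iff:
  assumes G: "simple_graph G"
  shows "graph_isomorphic G H \<longleftrightarrow> (\<exists>f. inj_on f (pverts G) \<and> H = map_graph f G)"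
proof
  assume "graph_isomorphic G H"
  then obtain h where h: "pre_digraph.digraph_isomorphism (with_proj G) h"
    and eq: "with_proj H = app_iso h (with_proj G)"
    unfolding graph_isomorphic_def digraph_iso_def by blast
  have H: "pverts H = iso_verts h ` pverts G" "parcs H = iso_arcs h ` parcs G"
    "iso_tail h = fst" "iso_head h = snd"
    using eq by (simp_all add: with_proj_def app_iso_def)
  have inj: "inj_on (iso_verts h) (pverts G)"
    using h by (simp add: pre_digraph.digraph_isomorphism_def)
  have "iso_arcs h a = map_prod (iso_verts h) (iso_verts h) a" if "a \<in> parcs G" for a
    using h that H(3,4) by (cases a) (auto simp: pre_digraph.digraph_isomorphism_def prod_eq_iff)
  then have "parcs H = map_prod (iso_verts h) (iso_verts h) ` parcs G"
    unfolding H(2) by (intro image_cong) auto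
  then have "H = map_graph (iso_verts h) G"
    using H(1) by (simp add: map_graph_def)
  then show "\<exists>f. inj_on f (pverts G) \<and> H = map_graph f G" using inj by blast
next
  assume "\<exists>f. inj_on f (pverts G) \<and> H = map_graph f G"
  then obtain f where f: "inj_on f (pverts G)" "H = map_graph f G" by blast
  define h where "h = \<lparr>iso_verts = f, iso_arcs = map_prod f f, iso_head = snd, iso_tail = fst\<rparr>"
  have "inj_on (map_prod f f) (parcs G)"
    using map_prod_inj_on[OF f(1) f(1)] simple_graphD(3)[OF G] by (rule inj_on_subset)
  then have "pre_digraph.digraph_isomorphism (with_proj G) h"
    using f(1) simple_graphD(7)[OF G] by (simp add: pre_digraph.digraph_isomorphism_def h_def)
  moreover have "with_proj H = app_iso h (with_proj G)"
    using f(2) by (simp add: with_proj_def app_iso_def h_def map_graph_def)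
  ultimately show "graph_isomorphic G H"
    unfolding graph_isomorphic_def digraph_iso_def by blast
qed

lemma map_graph_arc_iff:
  assumes G: "simple_graph G" and f: "inj_on f (pverts G)" and "x \<in> pverts G" "y \<in> pverts G"
  shows "(f x, f y) \<in> parcs (map_graph f G) \<longleftrightarrow> (x, y) \<in> parcs G"
proof
  assume "(f x, f y) \<in> parcs (map_graph f G)"
  then obtain u v where uv: "(u, v) \<in> parcs G" "f x = f u" "f y = f v" by (auto simp: map_graph_def)
  then have "u \<in> pverts G" "v \<in> pverts G" using simple_graphD(3)[OF G] by auto
  then show "(x, y) \<in> parcs G" using uv f assms(3,4) by (metis inj_onD)
qed (force simp: map_graph_def)

lemma map_graph_simple:
  assumes G: "simple_graph G" and f: "inj_on f (pverts G)"
  shows "simple_graph (map_graph f G)"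
proof (rule simple_graphI)
  show "irrefl (parcs (map_graph f G))"
  proof (rule irreflI)
    fix z show "(z, z) \<notin> parcs (map_graph f G)"
    proof
      assume "(z, z) \<in> parcs (map_graph f G)"
      then obtain u v where uv: "(u, v) \<in> parcs G" "f u = f v" by (auto simp: map_graph_def)
      then have "u = v" using simple_graphD(3)[OF G] f by (meson SigmaE2 inj_onD subsetD)
      then show False using simple_graphD(6)[OF G uv(1)] by simp
    qed
  qed
  show "sym (parcs (map_graph f G))"
    using simple_graphD(5)[OF G] by (force simp: sym_def map_graph_def)
  show "parcs (map_graph f G) \<subseteq> pverts (map_graph f G) \<times> pverts (map_graph f G)"
    using simple_graphD(3)[OF G] by (auto simp: map_graph_def)
qed (use simple_graphD(1,2)[OF G] in \<open>auto simp: map_graph_def\<close>)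

lemma edge_count_map_graph:
  assumes G: "simple_graph G" and f: "inj_on f (pverts G)"
  shows "edge_count (map_graph f G) = edge_count G"
proof -
  have edges: "{{x, y} | x y. (x, y) \<in> parcs K} = (\<lambda>(x, y). {x, y}) ` parcs K"
    for K :: "'c pair_pre_digraph" by auto
  have "{{x, y} | x y. (x, y) \<in> parcs (map_graph f G)} = image f ` {{x, y} | x y. (x, y) \<in> parcs G}"
    unfolding edges by (simp add: map_graph_def image_image case_prod_beta)
  moreover have "inj_on (image f) {{x, y} | x y. (x, y) \<in> parcs G}"
    by (rule inj_on_image, rule inj_on_subset[OF f]) (use simple_graphD(3)[OF G] in auto)
  ultimately show ?thesis by (simp add: edge_count_def card_image)
qed

lemma map_graph_layering:
  assumes G: "simple_graph G" and f: "inj_on f (pverts G)" and V: "layering t G V" "saturated t G V"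
  shows "layering t (map_graph f G) (\<lambda>i. f ` V i)" "saturated t (map_graph f G) (\<lambda>i. f ` V i)"
    "i \<le> t \<Longrightarrow> card (f ` V i) = card (V i)"
proof -
  have part: "indexed_partition t (pverts G) V" using V by (simp add: layering_def)
  have sub: "V i \<subseteq> pverts G" if "i \<le> t" for i using indexed_partitionD(1)[OF part that] .
  have arc: "(f x, f y) \<in> parcs (map_graph f G) \<longleftrightarrow> (x, y) \<in> parcs G"
    if "i \<le> t" "j \<le> t" "x \<in> V i" "y \<in> V j" for i j x y
    using map_graph_arc_iff[OF G f] sub that by blast
  show card: "i \<le> t \<Longrightarrow> card (f ` V i) = card (V i)" for i
    using inj_on_subset[OF f sub] by (rule card_image)
  have "f ` V i \<inter> f ` V j = {}" if "i \<le> t" "j \<le> t" "i \<noteq> j" for i j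
    using inj_on_image_Int[OF f sub[OF that(1)] sub[OF that(2)]] indexed_partitionD(3)[OF part] that
    by (metis disjoint_iff image_empty)
  moreover have "(\<Union>i\<le>t. f ` V i) = f ` (\<Union>i\<le>t. V i)" by blast
  ultimately have "indexed_partition t (pverts (map_graph f G)) (\<lambda>i. f ` V i)"
    using part by (simp add: indexed_partition_def disjoint_family_on_def map_graph_def)
  then show "layering t (map_graph f G) (\<lambda>i. f ` V i)"
    using V(1) arc unfolding layering_def by blast
  show "saturated t (map_graph f G) (\<lambda>i. f ` V i)"
    unfolding saturated_def
  proof (intro allI impI ballI)
    fix i j z
    assume ij: "i \<le> t" "j \<le> t"
      "0 < card (f ` V i) \<and> card (f ` V i) \<le> card (f ` V j) \<and> 2 \<le> \<bar>int i - int j\<bar>"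
      and "z \<in> f ` V i"
    then obtain x where x: "x \<in> V i" "z = f x" by blast
    have "\<exists>!y. y \<in> V j \<and> (x, y) \<in> parcs G"
      using V(2) ij x(1) card unfolding saturated_def by simp
    then obtain y where y: "y \<in> V j" "(x, y) \<in> parcs G" "\<And>y'. y' \<in> V j \<Longrightarrow> (x, y') \<in> parcs G \<Longrightarrow> y' = y"
      by blast
    show "\<exists>!w. w \<in> f ` V j \<and> (z, w) \<in> parcs (map_graph f G)"
    proof (rule ex1I[of _ "f y"])
      show "f y \<in> f ` V j \<and> (z, f y) \<in> parcs (map_graph f G)"
        using y arc[OF ij(1,2) x(1)] x(2) by blast
      fix w assume w: "w \<in> f ` V j \<and> (z, w) \<in> parcs (map_graph f G)"
      then obtain y' where "y' \<in> V j" "w = f y'" by blast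
      then show "w = f y" using w y(3) arc[OF ij(1,2) x(1)] x(2) by metis
    qed
  qed
qed

section \<open>The characterisation\<close>

lemma stationary_graphI:
  assumes H: "simple_graph H" and t: "3 \<le> t" and n: "t + 1 \<le> card (pverts H)"
    and V: "layering t H V" "saturated t H V"
    and tight: "int (matching_total t (\<lambda>i. card (V i))) = edge_bound t (\<Sum>i\<le>t. card (V i))"
    and shape: "satisfies_exactly_one_of t V UNIV"
  shows "stationary_graph t H V"
proof -
  have "(\<Sum>i\<le>t. card (V i)) = card (pverts H)"
    using V(1) simple_graphD(1)[OF H] by (intro sum_card_indexed_partition) (auto simp: layering_def)
  note ends = tight_ends[OF t tight, unfolded this, OF n]
  have "V 0 \<noteq> {}" "V t \<noteq> {}" using ends(1,2) by auto
  moreover have "V (i - 1) \<noteq> {} \<and> V (i + 1) \<noteq> {}" if "1 \<le> i" "i \<le> t - 1" "V i = {}" for i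
  proof -
    have "i < t" "i - 1 < t" "i - 1 + 1 = i" using that t by simp_all
    then show ?thesis using ends(3)[of i] ends(3)[of "i - 1"] that(3) by auto
  qed
  ultimately show ?thesis
    using assms layering_iff[OF H, of t V] unfolding stationary_graph_def saturated_def by auto
qed

text \<open>The necessity of the conditions, for the given graph and partition: \<open>tight_cases\<close> leaves
  the lopsided patterns and the two-level vectors, and the latter are constant if \<open>t + 1\<close> divides \<open>n\<close>
  and otherwise have the smallest possible \<open>K_value\<close>.\<close>

lemma tight_partition_conditions:
  fixes H :: "'a pair_pre_digraph"
  assumes H: "simple_graph H" and t: "3 \<le> t" and n: "t + 1 \<le> n" "card (pverts H) = n"
    and V: "layering t H V" "saturated t H V"
    and tight: "int (matching_total t (\<lambda>i. card (V i))) = edge_bound t (\<Sum>i\<le>t. card (V i))"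
  shows "exactly_one_of_three
        (n mod (t + 1) = 0 \<and> H \<in> G_family t (n div (t + 1)))
        (n mod (t + 1) \<noteq> 0 \<and> stationary_graph t H V \<and> satisfies t V Pa \<and>
          (\<forall>(H' :: 'b pair_pre_digraph) U.
             simple_graph H' \<and> card (pverts H') = n \<and> indexed_partition t (pverts H') U \<and>
             equitable t U \<and> \<not> equally_sized t U \<longrightarrow> K_value t V \<le> K_value t U))
        (n mod (t + 1) \<noteq> 0 \<and> stationary_graph t H V \<and>
          satisfies_exactly_one_of t V {Pb, Pc, Pd, Pe, Pf, Pg})"
proof -
  have part: "indexed_partition t (pverts H) V" using V(1) by (simp add: layering_def)
  have sum: "(\<Sum>i\<le>t. card (V i)) = n"
    using part simple_graphD(1)[OF H] n(2) by (simp add: sum_card_indexed_partition)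
  from tight_cases[OF t tight] show ?thesis
  proof
    assume "lopsided t (\<lambda>i. card (V i))"
    moreover from this have "satisfies_exactly_one_of t V {Pb, Pc, Pd, Pe, Pf, Pg}"
      by (simp add: lopsided_iff_satisfies)
    moreover from this have "satisfies_exactly_one_of t V UNIV"
      unfolding satisfies_exactly_one_of_iff by blast
    then have "stationary_graph t H V"
      using stationary_graphI[OF H t _ V tight] n by simp
    ultimately show ?thesis
      using lopsided_mod[of t "\<lambda>i. card (V i)"] lopsided_not_equitable[of t V] sum
      by (simp add: exactly_one_of_three_def)
  next
    assume "\<exists>q. \<forall>i\<le>t. card (V i) = q \<or> card (V i) = q + 1"
    then obtain S where S: "S \<subseteq> {..t}" "card S = n mod (t + 1)"
      "\<And>i. i \<le> t \<Longrightarrow> card (V i) = n div (t + 1) + of_bool (i \<in> S)"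
      using two_level_form[of t "\<lambda>i. card (V i)", OF _ sum] by blast
    show ?thesis
    proof (cases "n mod (t + 1) = 0")
      case True
      then have "S = {}" using S(1,2) finite_subset[OF S(1)] by simp
      then have card: "card (V i) = n div (t + 1)" if "i \<le> t" for i using S(3)[OF that] by simp
      have "0 < n div (t + 1)" using n(1) by (simp add: div_greater_zero_iff)
      then have match: "\<forall>x\<in>V i. \<exists>!y. y \<in> V j \<and> (x, y) \<in> parcs H"
        if "i \<le> t" "j \<le> t" "2 \<le> \<bar>int i - int j\<bar>" for i j
        using V(2) that card unfolding saturated_def by simp
      have sym: "(x, y) \<in> parcs H \<longleftrightarrow> (y, x) \<in> parcs H" for x y
        using simple_graphD(5)[OF H] by blast
      have "perfect_matching_between H (V m) (V p)" if "m + 2 \<le> p" "p \<le> t" for m p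
        using match[of m p] match[of p m] that unfolding perfect_matching_between_def
        by (subst (2) sym) simp
      then have "H \<in> G_family t (n div (t + 1))"
        using H part card layering_iff[OF H, of t V] V(1) unfolding G_family_def by blast
      then show ?thesis using True by (simp add: exactly_one_of_three_def)
    next
      case False
      have eq: "equitable t V" using S(3) by (rule two_level_equitable)
      then have "satisfies t V Pa" by simp
      then have "satisfies_exactly_one_of t V UNIV" unfolding satisfies_exactly_one_of_iff by blast
      then have "stationary_graph t H V"
        using n by (intro stationary_graphI[OF H t _ V tight]) simp_all
      have cS: "card S \<le> t" unfolding S(2) by (simp flip: less_Suc_eq_le)
      have S': "S \<noteq> {}" using S(2) False by auto
      have K: "int (K_value t V) = crowding t (n mod (t + 1))"
        using two_level_tight_iff(2)[OF S(1) cS S(3)] tight K_value_two_level[OF S(3,1) S'] S(2) by simp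
      have "K_value t V \<le> K_value t U"
        if U: "simple_graph H'" "card (pverts H') = n" "indexed_partition t (pverts H') U" "equitable t U"
        for H' :: "'b pair_pre_digraph" and U
      proof -
        have "(\<Sum>i\<le>t. card (U i)) = n"
          using U simple_graphD(1)[OF U(1)] by (simp add: sum_card_indexed_partition)
        then obtain T where T: "T \<subseteq> {..t}" "card T = n mod (t + 1)"
          "\<And>i. i \<le> t \<Longrightarrow> card (U i) = n div (t + 1) + of_bool (i \<in> T)"
          using two_level_form[of t "\<lambda>i. card (U i)"] equitable_two_level[OF U(4)] by metis
        then have "T \<noteq> {}" using False by auto
        then have "crowding t (n mod (t + 1)) \<le> int (K_value t U)"
          using K_value_two_level[OF T(3,1)] crowding_le_consecutive[OF T(1)] T(2) by simp
        then show ?thesis using K by simp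
      qed
      moreover have "\<not> satisfies_exactly_one_of t V {Pb, Pc, Pd, Pe, Pf, Pg}"
        using lopsided_not_equitable eq unfolding lopsided_iff_satisfies by blast
      ultimately show ?thesis
        using False \<open>stationary_graph t H V\<close> \<open>satisfies t V Pa\<close> unfolding exactly_one_of_three_def by blast
    qed
  qed
qed

text \<open>The sufficiency: each condition makes the size vector of a saturated layering tight. For
  equitable partitions this is where the minimality of \<open>K_value\<close> enters, by comparison with the
  partition of the extremal level graph.\<close>

lemma conditions_edge_count:
  fixes H :: "'a pair_pre_digraph"
  assumes t: "3 \<le> t" and n: "t + 1 \<le> n" "card (pverts H) = n"
    and cond: "exactly_one_of_three
        (n mod (t + 1) = 0 \<and> H \<in> G_family t (n div (t + 1)))
        (n mod (t + 1) \<noteq> 0 \<and> stationary_graph t H V \<and> satisfies t V Pa \<and>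
          (\<forall>(H' :: nat pair_pre_digraph) U.
             simple_graph H' \<and> card (pverts H') = n \<and> indexed_partition t (pverts H') U \<and>
             equitable t U \<and> \<not> equally_sized t U \<longrightarrow> K_value t V \<le> K_value t U))
        (n mod (t + 1) \<noteq> 0 \<and> stationary_graph t H V \<and>
          satisfies_exactly_one_of t V {Pb, Pc, Pd, Pe, Pf, Pg})"
  shows "int (edge_count H) = edge_bound t n"
proof -
  have count: "int (edge_count H) = edge_bound t n"
    if "simple_graph H" "layering t H W" "saturated t H W"
      "int (matching_total t (\<lambda>i. card (W i))) = edge_bound t (\<Sum>i\<le>t. card (W i))" for W
  proof -
    have "(\<Sum>i\<le>t. card (W i)) = n"
      using that(1,2) simple_graphD(1)[OF that(1)] n(2)
      by (auto simp: layering_def sum_card_indexed_partition)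
    then show ?thesis using that saturated_edge_count by metis
  qed
  have stat: "simple_graph H" "layering t H V" "saturated t H V" "indexed_partition t (pverts H) V"
    if "stationary_graph t H V"
  proof -
    note conds = that[unfolded stationary_graph_def]
    from conds show H: "simple_graph H" by (elim conjE)
    from conds show part: "indexed_partition t (pverts H) V" by (elim conjE)
    from conds have "\<forall>i\<le>t. edges_between H (V i) (V i) = 0" by (elim conjE)
    moreover from conds have "\<forall>i<t. edges_between H (V i) (V (i + 1)) = 0" by (elim conjE)
    ultimately show "layering t H V" using H part by (simp add: layering_iff)
    show "saturated t H V" unfolding saturated_def using conds by (elim conjE)
  qed
  consider "H \<in> G_family t (n div (t + 1))"
    | "n mod (t + 1) \<noteq> 0" "stationary_graph t H V" "equitable t V"
      "\<forall>(H' :: nat pair_pre_digraph) U.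
         simple_graph H' \<and> card (pverts H') = n \<and> indexed_partition t (pverts H') U \<and>
         equitable t U \<and> \<not> equally_sized t U \<longrightarrow> K_value t V \<le> K_value t U"
    | "stationary_graph t H V" "satisfies_exactly_one_of t V {Pb, Pc, Pd, Pe, Pf, Pg}"
    using cond unfolding exactly_one_of_three_def by auto
  then show ?thesis
  proof cases
    case 1
    then obtain W where H: "simple_graph H" and W: "indexed_partition t (pverts H) W"
      "\<And>i. i \<le> t \<Longrightarrow> card (W i) = n div (t + 1)"
      "\<And>m p. m + 2 \<le> p \<Longrightarrow> p \<le> t \<Longrightarrow> perfect_matching_between H (W m) (W p)"
      "\<forall>m\<le>t. edges_between H (W m) (W m) = 0" "\<forall>m<t. edges_between H (W m) (W (m + 1)) = 0"
      unfolding G_family_def mem_Collect_eq by (elim conjE exE) metis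
    have sym: "(x, y) \<in> parcs H \<longleftrightarrow> (y, x) \<in> parcs H" for x y
      using simple_graphD(5)[OF H] by blast
    have "saturated t H W"
      unfolding saturated_def
    proof (intro allI impI)
      fix i j assume ij: "i \<le> t" "j \<le> t" "0 < card (W i) \<and> card (W i) \<le> card (W j) \<and> 2 \<le> \<bar>int i - int j\<bar>"
      then consider "i + 2 \<le> j" | "j + 2 \<le> i" by linarith
      then show "\<forall>x\<in>W i. \<exists>!y. y \<in> W j \<and> (x, y) \<in> parcs H"
      proof cases
        case 1
        then show ?thesis using W(3) ij unfolding perfect_matching_between_def by blast
      next
        case 2
        then have "\<forall>x\<in>W i. \<exists>!y. y \<in> W j \<and> (y, x) \<in> parcs H"
          using W(3) ij unfolding perfect_matching_between_def by blast
        then show ?thesis by (subst sym)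
      qed
    qed
    moreover have "layering t H W" using layering_iff[OF H] W by blast
    moreover have "int (matching_total t (\<lambda>i. card (W i))) = edge_bound t (\<Sum>i\<le>t. card (W i))"
      using two_level_tight_iff(2)[of "{}" t "\<lambda>i. card (W i)" "n div (t + 1)"] W(2)
      by (simp add: crowding_def)
    ultimately show ?thesis using count H by blast
  next
    case 2
    have sum: "(\<Sum>i\<le>t. card (V i)) = n"
      using stat(1,4)[OF 2(2)] simple_graphD(1) n(2) by (metis sum_card_indexed_partition)
    then obtain S where S: "S \<subseteq> {..t}" "card S = n mod (t + 1)"
      "\<And>i. i \<le> t \<Longrightarrow> card (V i) = n div (t + 1) + of_bool (i \<in> S)"
      using two_level_form[of t "\<lambda>i. card (V i)"] equitable_two_level[OF 2(3)] by metis
    obtain H' :: "nat pair_pre_digraph" and U T where H': "simple_graph H'" "card (pverts H') = n"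
        "lambda_number H' = t" "int (edge_count H') = edge_bound t n" "indexed_partition t (pverts H') U"
      and T: "T \<subseteq> {..t}" "card T = n mod (t + 1)"
        "int (card {i \<in> T. Suc i \<in> T}) = crowding t (n mod (t + 1))"
        "\<forall>i\<le>t. card (U i) = n div (t + 1) + of_bool (i \<in> T)"
      by (rule extremal_level_graph[OF t n(1)])
    note U = T(4)[rule_format]
    have ne: "S \<noteq> {}" "T \<noteq> {}" using S(2) T(2) 2(1) by auto
    have "\<not> equally_sized t U"
    proof
      assume eq: "equally_sized t U"
      have "(\<Sum>i\<le>t. card (U i)) = (\<Sum>i\<le>t. card (U 0))"
      proof (rule sum.cong)
        show "card (U i) = card (U 0)" if "i \<in> {..t}" for i
          using eq that unfolding equally_sized_def by blast
      qed simp
      then have "n = (t + 1) * card (U 0)"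
        using sum_card_indexed_partition[OF H'(5) simple_graphD(1)[OF H'(1)]] H'(2) by simp
      then show False using 2(1) by (metis mod_mult_self1_is_0)
    qed
    then have "K_value t V \<le> K_value t U"
      using 2(4)[rule_format, of H' U] H'(1,2,5) two_level_equitable[OF U] by blast
    then have "int (card {i \<in> S. Suc i \<in> S}) \<le> crowding t (card S)"
      using K_value_two_level[OF S(3,1) ne(1)] K_value_two_level[OF U T(1) ne(2)] S(2) T(3) by simp
    then have "int (card {i \<in> S. Suc i \<in> S}) = crowding t (card S)"
      using crowding_le_consecutive[OF S(1)] by simp
    moreover have "card S \<le> t" unfolding S(2) by (simp flip: less_Suc_eq_le)
    ultimately show ?thesis
      using two_level_tight_iff(2)[OF S(1) _ S(3)] by (intro count[OF stat(1-3)[OF 2(2)]]) blast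
  next
    case 3
    then show ?thesis
      using lopsided_tight[of t "\<lambda>i. card (V i)"] count stat[OF 3(1)] by (simp add: lopsided_iff_satisfies)
  qed
qed

theorem theorem4p9:
  fixes G :: "'a pair_pre_digraph" and n t :: nat
  assumes "simple_graph G" and "card (pverts G) = n"
    and "lambda_number G = t" and "t \<ge> 3" and "n \<ge> t + 1"
  shows "has_max_edges G \<longleftrightarrow>
    (\<exists>(H :: nat pair_pre_digraph) V. graph_isomorphic G H \<and> card (pverts H) = n \<and>
      exactly_one_of_three
        (n mod (t + 1) = 0 \<and> H \<in> G_family t (n div (t + 1)))
        (n mod (t + 1) \<noteq> 0 \<and> stationary_graph t H V \<and> satisfies t V Pa \<and>
          (\<forall>(H' :: nat pair_pre_digraph) U.
             simple_graph H' \<and> card (pverts H') = n \<and> indexed_partition t (pverts H') U \<and>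
             equitable t U \<and> \<not> equally_sized t U \<longrightarrow> K_value t V \<le> K_value t U))
        (n mod (t + 1) \<noteq> 0 \<and> stationary_graph t H V \<and>
          satisfies_exactly_one_of t V {Pb, Pc, Pd, Pe, Pf, Pg}))"
    (is "_ \<longleftrightarrow> (\<exists>H V. ?iso H \<and> ?card H \<and> ?cond H V)")
proof -
  note G = assms(1)
  have max_iff: "has_max_edges G \<longleftrightarrow> int (edge_count G) = edge_bound t n"
    using has_max_edges_iff[OF G assms(3,4)] assms(2,5) by simp
  show ?thesis
  proof
    assume "has_max_edges G"
    then have max: "int (edge_count G) = edge_bound t (card (pverts G))"
      using max_iff assms(2) by simp
    obtain V where V: "layering t G V" "scattered t G V"
      using lambda_number_partition[OF G] assms(3) by blast
    from edge_count_le_edge_bound(2)[OF G assms(4) V max] have sat: "saturated t G V"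
      and tight: "int (matching_total t (\<lambda>i. card (V i))) = edge_bound t (\<Sum>i\<le>t. card (V i))" by auto
    obtain f :: "'a \<Rightarrow> nat" where f: "inj_on f (pverts G)"
      using finite_imp_inj_to_nat_seg[OF simple_graphD(1)[OF G]] by metis
    define H W where "H = map_graph f G" "W = (\<lambda>i. f ` V i)"
    note HW = this
    note W = map_graph_layering[OF G f V(1) sat, folded HW]
    have H: "simple_graph H" "card (pverts H) = n"
      using map_graph_simple[OF G f] card_image[OF f] assms(2) by (simp_all add: HW map_graph_def)
    have cW: "card (W i) = card (V i)" if "i \<le> t" for i using W(3)[OF that] by (simp add: HW)
    have "matching_total t (\<lambda>i. card (W i)) = matching_total t (\<lambda>i. card (V i))"
      unfolding matching_total_def using cW by (intro sum.cong) (auto simp: spread_pairs_def)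
    moreover have "(\<Sum>i\<le>t. card (W i)) = (\<Sum>i\<le>t. card (V i))"
      using cW by (intro sum.cong) auto
    ultimately have "?cond H W"
      using tight_partition_conditions[OF H(1) assms(4,5) H(2) W(1,2)] tight by simp
    moreover have "graph_isomorphic G H"
      unfolding graph_isomorphic_iff[OF G] HW using f by blast
    ultimately show "\<exists>H V. ?iso H \<and> ?card H \<and> ?cond H V" using H(2) by blast
  next
    assume "\<exists>H V. ?iso H \<and> ?card H \<and> ?cond H V"
    then obtain H V where H: "graph_isomorphic G H" "card (pverts H) = n" "?cond H V" by blast
    have "edge_count H = edge_count G"
      using H(1) edge_count_map_graph[OF G] unfolding graph_isomorphic_iff[OF G] by blast
    then show "has_max_edges G"
      using conditions_edge_count[OF assms(4,5) H(2,3)] max_iff by simp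
  qed
qed

end
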